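(* Let $r\ge1$, let $x,x_1,\dots,x_r$ be roots of unity with $x\ne1$, let $a\in\mathbb{C}\setminus\mathbb{Z}$, and let $p_1,\dots,p_r,q\ge1$ be integers with $(p_j,x_j)\neq(1,1)$ for all $j$ and $(q,xx_1\cdots x_r)\ne(1,1)$. Then \[ x\,S_{p_1,\dots,p_r;q}^{(a-1)}\big(x_1,\dots,x_r;(xx_1\cdots x_r)^{-1}\big)+(-1)^{p_1+\cdots+p_r+q+r}S_{p_1,\dots,p_r;q}^{(-a)}\big(x_1^{-1},\dots,x_r^{-1};xx_1\cdots x_r\big) \] reduces to a combination of sums of lower orders, i.e. it equals a finite linear combination, with coefficients in $\mathbb{Q}(x,x_1,\dots,x_r)$, of products of values $\mathrm{Li}_m(w;b)$ ($w$ a root of unity, $b\in\{1,a,1-a\}$) and of Euler sums of the forms $S^{(a-1)}$, $S^{(-a)}$ and classical cyclotomic Euler sums $S$ of degree less than $r$.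
   Context: For $|w|\le1$, $m\in\mathbb{N}$ with $(m,w)\ne(1,1)$, $b\in\mathbb{C}\setminus\{0,-1,-2,\dots\}$: $\mathrm{Li}_m(w;b)=\sum_{n\ge1}\frac{w^n}{(n+b-1)^m}$ (so $\mathrm{Li}_m(w;1)$ is the polylogarithm). For $n\ge0$: $\zeta_n(p;w;b)=\sum_{k=1}^n\frac{w^k}{(k+b)^p}$, $\zeta_n(p;w)=\sum_{k=1}^n\frac{w^k}{k^p}$. For roots of unity $u_1,\dots,u_k,v$, positive integers $p_1,\dots,p_k,q$ with $(q,v)\ne(1,1)$ and $b\in\mathbb{C}\setminus\mathbb{Z}$: $S^{(b)}_{p_1,\dots,p_k;q}(u_1,\dots,u_k;v)=\sum_{n\ge1}\frac{\zeta_n(p_1;u_1;b)\cdots\zeta_n(p_k;u_k;b)}{(n+b)^q}v^n$, and the classical cyclotomic Euler sum is $S_{p_1,\dots,p_k;q}(u_1,\dots,u_k;v)=\sum_{n\ge1}\frac{\zeta_n(p_1;u_1)\cdots\zeta_n(p_k;u_k)}{n^q}v^n$. The integer $k$ is the degree (order) of such a sum. *)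

theory Defs
  imports "HOL-Analysis.Analysis"
begin

definition root_of_unity :: "complex \<Rightarrow> bool" where
  "root_of_unity w \<longleftrightarrow> (\<exists>n::nat. n > 0 \<and> w ^ n = 1)"

text \<open>In the series below the summation index is shifted, so that \<open>Suc n\<close> runs through
  the positive integers. All series are ordinary (ordered) sums, since for weight 1 they
  converge only conditionally.\<close>

definition Li :: "nat \<Rightarrow> complex \<Rightarrow> complex \<Rightarrow> complex" where
  "Li m w b = (\<Sum>n. w ^ Suc n / (of_nat (Suc n) + b - 1) ^ m)"

definition zeta_partial :: "nat \<Rightarrow> nat \<Rightarrow> complex \<Rightarrow> complex \<Rightarrow> complex" where
  "zeta_partial n p w b = (\<Sum>k=1..n. w ^ k / (of_nat k + b) ^ p)"

text \<open>\<open>euler_S b k p q u v\<close> is the sum of degree \<open>k\<close> with parameters \<open>p 1, \<dots>, p k; q\<close>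
  and \<open>u 1, \<dots>, u k; v\<close>; only the values of \<open>p\<close> and \<open>u\<close> on \<open>{1..k}\<close> matter.
  At \<open>b = 0\<close> it is literally the classical cyclotomic Euler sum.\<close>

definition euler_S ::
  "complex \<Rightarrow> nat \<Rightarrow> (nat \<Rightarrow> nat) \<Rightarrow> nat \<Rightarrow> (nat \<Rightarrow> complex) \<Rightarrow> complex \<Rightarrow> complex" where
  "euler_S b k p q u v =
     (\<Sum>n. (\<Prod>j=1..k. zeta_partial (Suc n) (p j) (u j) b) / (of_nat (Suc n) + b) ^ q * v ^ Suc n)"

abbreviation classical_euler_S ::
  "nat \<Rightarrow> (nat \<Rightarrow> nat) \<Rightarrow> nat \<Rightarrow> (nat \<Rightarrow> complex) \<Rightarrow> complex \<Rightarrow> complex" where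
  "classical_euler_S \<equiv> euler_S 0"

text \<open>The subfield \<open>\<rat>(H)\<close> of the complex numbers generated by \<open>H\<close>; it contains \<open>\<rat>\<close>
  because it contains 1.\<close>

inductive_set rat_adjoin :: "complex set \<Rightarrow> complex set" for H where
  one: "1 \<in> rat_adjoin H"
| incl: "h \<in> H \<Longrightarrow> h \<in> rat_adjoin H"
| uminus: "h \<in> rat_adjoin H \<Longrightarrow> - h \<in> rat_adjoin H"
| inverse: "h \<in> rat_adjoin H \<Longrightarrow> h \<noteq> 0 \<Longrightarrow> inverse h \<in> rat_adjoin H"
| add: "g \<in> rat_adjoin H \<Longrightarrow> h \<in> rat_adjoin H \<Longrightarrow> g + h \<in> rat_adjoin H"
| mult: "g \<in> rat_adjoin H \<Longrightarrow> h \<in> rat_adjoin H \<Longrightarrow> g * h \<in> rat_adjoin H"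

definition Li_values :: "complex \<Rightarrow> complex set" where
  "Li_values a = {Li m w b | m w b.
     m \<ge> 1 \<and> root_of_unity w \<and> (m, w) \<noteq> (1, 1) \<and> b \<in> {1, a, 1 - a}}"

definition euler_sum_params ::
  "nat \<Rightarrow> (nat \<Rightarrow> nat) \<Rightarrow> nat \<Rightarrow> (nat \<Rightarrow> complex) \<Rightarrow> complex \<Rightarrow> bool" where
  "euler_sum_params k p q u v \<longleftrightarrow>
     (\<forall>j\<in>{1..k}. p j \<ge> 1 \<and> root_of_unity (u j)) \<and> q \<ge> 1 \<and> root_of_unity v \<and> (q, v) \<noteq> (1, 1)"

text \<open>Degree 0 is included; such a sum is itself a value of \<open>Li\<close>, namely \<open>Li q v (b + 1)\<close>.\<close>

definition lower_euler_sums :: "complex \<Rightarrow> nat \<Rightarrow> complex set" where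
  "lower_euler_sums a r =
     {euler_S (a - 1) k p q u v | k p q u v. k < r \<and> euler_sum_params k p q u v} \<union>
     {euler_S (- a) k p q u v | k p q u v. k < r \<and> euler_sum_params k p q u v} \<union>
     {classical_euler_S k p q u v | k p q u v. k < r \<and> euler_sum_params k p q u v}"

text \<open>Finite products with at least one factor; the empty product is not allowed, so no
  constant term is available.\<close>

definition finite_products :: "complex set \<Rightarrow> complex set" where
  "finite_products G = {prod_list fs | fs. fs \<noteq> [] \<and> set fs \<subseteq> G}"

definition linear_combinations :: "complex set \<Rightarrow> complex set \<Rightarrow> complex set" where
  "linear_combinations K P =
     {(\<Sum>i<N. c i * t i) | (N::nat) c t. \<forall>i<N. c i \<in> K \<and> t i \<in> P}"

end

theory Submission
  imports Defs "HOL-Computational_Algebra.Formal_Laurent_Series"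
begin

text \<open>Put \<open>\<phi>\<^sub>j(s) = (\<Sum>k\<ge>0. x\<^sub>j^k / (s + k)^p\<^sub>j)\<close> and sum
  \<open>x^(-n) (\<Prod>j. \<phi>\<^sub>j(s)) / s^q\<close> over the bilateral progression \<open>s = n + a\<close>, \<open>n \<in> \<int>\<close>.
  For \<open>n \<ge> 0\<close> the value of \<open>\<phi>\<^sub>j\<close> is, up to a power of \<open>x\<^sub>j\<close>, a value of \<open>Li\<close> minus a
  partial sum with parameter \<open>a - 1\<close>; for \<open>n < 0\<close> it is a value of \<open>Li\<close> plus a partial sum
  with parameter \<open>- a\<close>. So the two halves of the sum produce the two Euler sums of degree \<open>r\<close>
  and terms of lower degree. On the other hand the summand can be expanded into partial fractions.
  The polar part at \<open>s = 0\<close> involves only values of \<open>Li\<close>. A polar part at \<open>s = -k\<close>, \<open>k \<ge> 1\<close>,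
  uses the pole of at least one \<open>\<phi>\<^sub>j\<close>, so only the regular parts of at
  most \<open>r - 1\<close> of them contribute partial sums, and summing over \<open>k\<close> gives classical Euler sums of
  degree below \<open>r\<close>, times bilateral sums of \<open>x^(-n) / (n + a)^i\<close>, which are values of \<open>Li\<close>.

  Since the series converge only conditionally, \<open>\<phi>\<^sub>j\<close> is truncated at \<open>k \<le> K\<close> and \<open>n\<close> at
  \<open>-K \<le> n < K\<close>; everything is then finite, and each error as \<open>K \<rightarrow> \<infinity>\<close> is dominated by
  \<open>\<Sum>m=1..K. 1 / (m (K + 1 - m))\<close>, which tends to 0.\<close>

subsection \<open>Convergence of the partial sums\<close>

lemma root_of_unity_norm: "root_of_unity w \<Longrightarrow> norm w = 1"
  unfolding root_of_unity_def using power_eq_1_iff by blast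

lemma root_of_unity_nonzero: "root_of_unity w \<Longrightarrow> w \<noteq> 0"
  using root_of_unity_norm[of w] by auto

lemma root_of_unity_inverse: "root_of_unity w \<Longrightarrow> root_of_unity (inverse w)"
  unfolding root_of_unity_def by (metis power_inverse inverse_1)

lemma root_of_unity_mult: "root_of_unity v \<Longrightarrow> root_of_unity w \<Longrightarrow> root_of_unity (v * w)"
proof -
  assume "root_of_unity v" "root_of_unity w"
  then obtain m n where "m > 0" "n > 0" "v ^ m = 1" "w ^ n = 1"
    by (auto simp: root_of_unity_def)
  then have "v ^ (m * n) = 1" "w ^ (n * m) = 1" "m * n > 0"
    by (simp_all add: power_mult)
  then have "(v * w) ^ (m * n) = 1" "m * n > 0"
    by (simp_all add: power_mult_distrib mult.commute)
  then show ?thesis unfolding root_of_unity_def by blast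
qed

lemma root_of_unity_1 [simp]: "root_of_unity 1"
  unfolding root_of_unity_def by (intro exI[of _ 1]) simp

lemma root_of_unity_prod:
  "(\<And>j. j \<in> J \<Longrightarrow> root_of_unity (f j)) \<Longrightarrow> root_of_unity (\<Prod>j\<in>J. f j)"
  by (induction J rule: infinite_finite_induct) (simp_all add: root_of_unity_mult)

text \<open>Keeps every denominator of index n \<ge> 1 nonzero. The values of \<open>b\<close> that
  occur are 0, for the classical sums, and a - 1 and -a.\<close>

definition nonpole :: "complex \<Rightarrow> bool" where
  "nonpole b \<longleftrightarrow> (\<forall>n\<ge>1. of_nat n + b \<noteq> 0)"

text \<open>The quotient n/(n + b) tends to 1 and is therefore bounded. A bound \<open>C\<close> for
  it gives the estimate for p = 1, and taking powers gives it for every p with the same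
  \<open>C\<close>.\<close>

lemma nonpole_bound:
  assumes "nonpole b"
  obtains C where "C > 0" "\<And>n p. n \<ge> 1 \<Longrightarrow> norm (1 / (of_nat n + b) ^ p) \<le> C ^ p / real n ^ p"
proof -
  have "(\<lambda>n. of_nat n / (of_nat n + b)) \<longlonglongrightarrow> 1"
  proof (rule Lim_transform_eventually)
    show "(\<lambda>n. 1 / (1 + b / of_nat n)) \<longlonglongrightarrow> 1"
      using tendsto_divide[OF tendsto_const[of 1] tendsto_add[OF tendsto_const[of 1] lim_const_over_n[of b]]]
      by simp
    show "\<forall>\<^sub>F n in sequentially. 1 / (1 + b / of_nat n) = of_nat n / (of_nat n + b)"
      using eventually_gt_at_top[of 0]
    proof eventually_elim
      case (elim n)
      then have "of_nat n + b \<noteq> 0" using assms by (auto simp: nonpole_def)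
      moreover have "1 + b / of_nat n = (of_nat n + b) / of_nat n" using elim by (simp add: field_simps)
      ultimately show ?case by simp
    qed
  qed
  then have "Bseq (\<lambda>n. of_nat n / (of_nat n + b))" by (rule convergent_imp_Bseq[OF convergentI])
  then obtain C where C: "C > 0" "\<And>n. norm (of_nat n / (of_nat n + b)) \<le> C"
    by (auto simp: Bseq_def)
  show ?thesis
  proof
    fix n p :: nat assume n: "n \<ge> 1"
    have "norm (1 / (of_nat n + b)) \<le> C / real n"
      using C(2)[of n] n by (simp add: norm_divide field_simps)
    then have "norm (1 / (of_nat n + b)) ^ p \<le> (C / real n) ^ p" by (intro power_mono) auto
    then show "norm (1 / (of_nat n + b) ^ p) \<le> C ^ p / real n ^ p"
      by (simp add: norm_divide norm_power power_divide)
  qed (rule C(1))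
qed

text \<open>Comparison with a telescoping series: 1/(n+1)^2 is at most 2 (1/(n+1) - 1/(n+2)),
  because n + 2 \<le> 2 (n + 1). From index \<open>N\<close> on, the differences telescope to
  1/(N+1).\<close>

lemma inverse_square_tail:
  fixes f :: "nat \<Rightarrow> complex"
  assumes "\<And>n. norm (f n) \<le> C / real (Suc n) ^ 2"
  shows "summable f" "norm ((\<Sum>n. f n) - (\<Sum>n<N. f n)) \<le> 2 * C / real (Suc N)"
proof -
  have C: "C \<ge> 0" using order_trans[OF norm_ge_zero assms[of 0]] by simp
  have le: "norm (f n) \<le> 2 * C * (1 / real (Suc n) - 1 / real (Suc (Suc n)))" for n
  proof -
    have "1 / real (Suc n) ^ 2 \<le> 2 * (1 / real (Suc n) - 1 / real (Suc (Suc n)))"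
      by (simp add: divide_simps power2_eq_square)
    then have "C * (1 / real (Suc n) ^ 2) \<le> C * (2 * (1 / real (Suc n) - 1 / real (Suc (Suc n))))"
      using C by (rule mult_left_mono)
    then show ?thesis using assms[of n] by (simp add: algebra_simps)
  qed
  have t: "(\<lambda>n. 1 / real (Suc (n + N)) - 1 / real (Suc (Suc (n + N)))) sums (1 / real (Suc N) - 0)" for N
  proof -
    have "(\<lambda>n. 1 / real (Suc (n + N))) \<longlonglongrightarrow> 0"
      using LIMSEQ_ignore_initial_segment[OF LIMSEQ_inverse_real_of_nat, of N]
      by (simp add: inverse_eq_divide)
    from telescope_sums'[OF this] show ?thesis by simp
  qed
  from t[of 0] have s: "summable (\<lambda>n. 2 * C * (1 / real (Suc n) - 1 / real (Suc (Suc n))))"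
    by (intro summable_mult) (auto simp: sums_iff)
  show sf: "summable f" by (rule summable_comparison_test'[OF s, of 0]) (use le in auto)
  have st: "(\<lambda>n. 2 * C * (1 / real (Suc (n + N)) - 1 / real (Suc (Suc (n + N))))) sums (2 * C / real (Suc N))"
    using sums_mult[OF t, of "2 * C" N] by simp
  have "(\<Sum>n. f n) - (\<Sum>n<N. f n) = (\<Sum>n. f (n + N))"
    using suminf_minus_initial_segment[OF sf, of N] by simp
  also have "norm \<dots> \<le> (\<Sum>n. 2 * C * (1 / real (Suc (n + N)) - 1 / real (Suc (Suc (n + N)))))"
    by (rule norm_suminf_le) (use le st in \<open>auto simp: sums_iff simp del: of_nat_Suc\<close>)
  also have "\<dots> = 2 * C / real (Suc N)" using st by (simp add: sums_iff)
  finally show "norm ((\<Sum>n. f n) - (\<Sum>n<N. f n)) \<le> 2 * C / real (Suc N)" .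
qed

lemma zeta_partial_0 [simp]: "zeta_partial 0 p w b = 0"
  by (simp add: zeta_partial_def)

lemma zeta_partial_Suc:
  "zeta_partial (Suc n) p w b = zeta_partial n p w b + w ^ Suc n / (of_nat (Suc n) + b) ^ p"
  by (simp add: zeta_partial_def)

lemma zeta_partial_eq_sum:
  "zeta_partial N p w b = (\<Sum>n<N. w ^ Suc n / (of_nat (Suc n) + b) ^ p)"
  by (induction N) (auto simp: zeta_partial_Suc)

text \<open>For \<open>p = 1\<close> and \<open>w \<noteq> 1\<close> summation by parts splits the sum into a boundary
  term and an absolutely convergent series.\<close>

lemma zeta_partial_converges:
  assumes w: "root_of_unity w" and p: "p \<ge> 1" "(p, w) \<noteq> (1, 1)" and b: "nonpole b"
  obtains L C where "\<And>N. norm (zeta_partial N p w b - L) \<le> C / real (Suc N)"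
proof -
  obtain C where C: "C > 0" "\<And>n p. n \<ge> 1 \<Longrightarrow> norm (1 / (of_nat n + b) ^ p) \<le> C ^ p / real n ^ p"
    using nonpole_bound[OF b] by blast
  have nw: "norm w = 1" using w by (rule root_of_unity_norm)
  show thesis
  proof (cases "p = 1")
    case False
    define f where "f n = w ^ Suc n / (of_nat (Suc n) + b) ^ p" for n
    have "norm (f n) \<le> C ^ p / real (Suc n) ^ 2" for n
    proof -
      have "norm (f n) = norm (1 / (of_nat (Suc n) + b) ^ p)"
        by (simp add: f_def norm_divide norm_mult norm_power nw)
      also have "\<dots> \<le> C ^ p / real (Suc n) ^ p" using C(2)[of "Suc n" p] by simp
      also have "\<dots> \<le> C ^ p / real (Suc n) ^ 2"
        using False p C by (intro divide_left_mono power_increasing) auto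
      finally show ?thesis .
    qed
    from inverse_square_tail(2)[OF this] show thesis
      by (intro that[of "\<Sum>n. f n" "2 * C ^ p"]) (simp add: zeta_partial_eq_sum f_def norm_minus_commute)
  next
    case True
    then have w1: "w \<noteq> 1" using p by auto
    define c where "c n = 1 / (of_nat (Suc n) + b)" for n
    \<comment> \<open>A discrete antiderivative of the powers of w: Y (n+1) - Y n = w^(n+1). It is
      bounded since |w| = 1 and w \<noteq> 1.\<close>
    define Y where "Y n = w ^ Suc n / (w - 1)" for n
    define f where "f n = Y (Suc n) * (c n - c (Suc n))" for n
    define D where "D = 1 / norm (w - 1)"
    have D: "D > 0" using w1 by (simp add: D_def)
    have nz: "of_nat (Suc n) + b \<noteq> 0" for n using b unfolding nonpole_def by (metis le_add1 plus_1_eq_Suc)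
    have nY: "norm (Y n) = D" for n by (simp add: Y_def D_def norm_divide norm_mult norm_power nw)
    have nc: "norm (c n) \<le> C / real (Suc n)" for n using C(2)[of "Suc n" 1] by (simp add: c_def)
    have "norm (f n) \<le> D * C ^ 2 / real (Suc n) ^ 2" for n
    proof -
      have "c n - c (Suc n) = c n * c (Suc n)"
        using nz[of n] nz[of "Suc n"] by (simp add: c_def field_simps)
      then have "norm (f n) = D * (norm (c n) * norm (c (Suc n)))"
        by (simp add: f_def norm_mult nY)
      also have "\<dots> \<le> D * (C / real (Suc n) * (C / real (Suc n)))"
      proof (intro mult_left_mono mult_mono)
        have "norm (c (Suc n)) \<le> C / real (Suc (Suc n))" by (rule nc)
        also have "\<dots> \<le> C / real (Suc n)" using C by (intro divide_left_mono) auto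
        finally show "norm (c (Suc n)) \<le> C / real (Suc n)" .
      qed (use nc C D in auto)
      finally show ?thesis by (simp add: power2_eq_square)
    qed
    note t = inverse_square_tail(2)[OF this]
    have e: "zeta_partial N p w b = Y N * c N - Y 0 * c 0 + (\<Sum>n<N. f n)" for N
    proof (induction N)
      case (Suc N)
      have "Y (Suc N) = Y N + w ^ Suc N" using w1 by (simp add: Y_def field_simps)
      then have "w ^ Suc N * c N = Y (Suc N) * c (Suc N) - Y N * c N + f N"
        by (simp add: f_def algebra_simps)
      moreover have "zeta_partial (Suc N) p w b = zeta_partial N p w b + w ^ Suc N * c N"
        by (simp only: zeta_partial_Suc) (simp add: True c_def)
      ultimately show ?case using Suc by simp
    qed simp
    show thesis
    proof (rule that)
      fix N
      have "zeta_partial N p w b - ((\<Sum>n. f n) - Y 0 * c 0)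
          = Y N * c N - ((\<Sum>n. f n) - (\<Sum>n<N. f n))" by (simp add: e)
      also have "norm \<dots> \<le> norm (Y N * c N) + norm ((\<Sum>n. f n) - (\<Sum>n<N. f n))"
        by (rule norm_triangle_ineq4)
      also have "\<dots> \<le> D * (C / real (Suc N)) + 2 * (D * C ^ 2) / real (Suc N)"
        using t[of N] mult_left_mono[OF nc[of N], of D] D
        by (intro add_mono) (simp_all only: norm_mult nY less_imp_le)
      also have "\<dots> = (D * C + 2 * (D * C ^ 2)) / real (Suc N)" by (simp add: add_divide_distrib)
      finally show "norm (zeta_partial N p w b - ((\<Sum>n. f n) - Y 0 * c 0))
        \<le> (D * C + 2 * (D * C ^ 2)) / real (Suc N)" .
    qed
  qed
qed

lemma const_over_Suc_tendsto: "(\<lambda>N. C / real (Suc N)) \<longlonglongrightarrow> 0"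
  using tendsto_mult[OF tendsto_const[of C] LIMSEQ_inverse_real_of_nat] by (simp add: divide_inverse)

text \<open>The parameter b + 1 compensates for the -1 in the denominators of \<open>Li\<close>. The
  rate 1/(N+1) is recorded, and not only the limit, because the truncation errors are measured by
  it.\<close>

lemma zeta_partial_Li:
  assumes "root_of_unity w" "p \<ge> 1" "(p, w) \<noteq> (1, 1)" "nonpole b"
  obtains C where "C \<ge> 0" "\<And>N. norm (zeta_partial N p w b - Li p w (b + 1)) \<le> C / real (Suc N)"
proof -
  obtain L C where C: "\<And>N. norm (zeta_partial N p w b - L) \<le> C / real (Suc N)"
    using zeta_partial_converges[OF assms] by blast
  have "(\<lambda>N. zeta_partial N p w b - L) \<longlonglongrightarrow> 0"
    by (rule Lim_null_comparison[OF _ const_over_Suc_tendsto[of C]]) (use C in auto)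
  then have "(\<lambda>N. zeta_partial N p w b) \<longlonglongrightarrow> L" by (simp add: LIM_zero_cancel)
  then have "(\<lambda>n. w ^ Suc n / (of_nat (Suc n) + b) ^ p) sums L"
    unfolding sums_def zeta_partial_eq_sum .
  then have "Li p w (b + 1) = L" by (simp add: Li_def sums_iff add.assoc)
  moreover have "C \<ge> 0" using order_trans[OF norm_ge_zero C[of 0]] by simp
  ultimately show thesis using that C by blast
qed

lemma zeta_partial_tendsto:
  assumes "root_of_unity w" "p \<ge> 1" "(p, w) \<noteq> (1, 1)" "nonpole b"
  shows "(\<lambda>N. zeta_partial N p w b) \<longlonglongrightarrow> Li p w (b + 1)"
proof -
  obtain C where C: "\<And>N. norm (zeta_partial N p w b - Li p w (b + 1)) \<le> C / real (Suc N)"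
    using zeta_partial_Li[OF assms] by blast
  have "(\<lambda>N. zeta_partial N p w b - Li p w (b + 1)) \<longlonglongrightarrow> 0"
    by (rule Lim_null_comparison[OF _ const_over_Suc_tendsto[of C]]) (use C in auto)
  then show ?thesis by (simp add: LIM_zero_cancel)
qed

lemma zeta_partial_bounded:
  assumes "root_of_unity w" "p \<ge> 1" "(p, w) \<noteq> (1, 1)" "nonpole b"
  obtains C where "C \<ge> 0" "\<And>N. norm (zeta_partial N p w b) \<le> C"
proof -
  obtain C where C: "\<And>N. norm (zeta_partial N p w b) \<le> C"
    using convergent_imp_Bseq[OF convergentI[OF zeta_partial_tendsto[OF assms]]] by (auto simp: Bseq_def)
  then show thesis using that order_trans[OF norm_ge_zero C] by blast
qed

subsection \<open>Truncation errors\<close>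

text \<open>\<open>F K m\<close> is a term of a sum truncated at \<open>K\<close>, and
  \<open>f m\<close> its limit. The error has the same decay in m as \<open>f\<close> and gains a
  factor for the distance from m to the cutoff. It need not be small for m near K; it only has to be
  small after summation over m. The distance is counted as K + 1 - m so that it is at least
  1.\<close>

definition approx :: "nat \<Rightarrow> (nat \<Rightarrow> nat \<Rightarrow> complex) \<Rightarrow> (nat \<Rightarrow> complex) \<Rightarrow> bool" where
  "approx e F f \<longleftrightarrow> (\<exists>C\<ge>0. \<forall>K m. 1 \<le> m \<and> m \<le> K \<longrightarrow>
     norm (f m) \<le> C / real m ^ e \<and> norm (F K m - f m) \<le> C / (real m ^ e * real (Suc K - m)))"

lemma approxI:
  assumes "\<And>m::nat. 1 \<le> m \<Longrightarrow> norm (f m) \<le> C / real m ^ e"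
    and "\<And>(K::nat) (m::nat). 1 \<le> m \<Longrightarrow> m \<le> K \<Longrightarrow>
      norm (F K m - f m) \<le> D / (real m ^ e * real (Suc K - m))"
  shows "approx e F f"
  unfolding approx_def
proof (intro exI[of _ "max 0 (max C D)"] conjI allI impI)
  fix K m :: nat assume m: "1 \<le> m \<and> m \<le> K"
  have "C / real m ^ e \<le> max 0 (max C D) / real m ^ e" by (intro divide_right_mono) auto
  then show "norm (f m) \<le> max 0 (max C D) / real m ^ e" using assms(1)[of m] m by linarith
  have "D / (real m ^ e * real (Suc K - m)) \<le> max 0 (max C D) / (real m ^ e * real (Suc K - m))"
    by (intro divide_right_mono) auto
  then show "norm (F K m - f m) \<le> max 0 (max C D) / (real m ^ e * real (Suc K - m))"
    using assms(2)[of m K] m by linarith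
qed simp

lemma approxE:
  assumes "approx e F f"
  obtains C where "C \<ge> 0" "\<And>m. 1 \<le> m \<Longrightarrow> norm (f m) \<le> C / real m ^ e"
    "\<And>K m. 1 \<le> m \<Longrightarrow> m \<le> K \<Longrightarrow> norm (F K m - f m) \<le> C / (real m ^ e * real (Suc K - m))"
proof -
  obtain C where "C \<ge> 0" "\<forall>K m. 1 \<le> m \<and> m \<le> K \<longrightarrow>
     norm (f m) \<le> C / real m ^ e \<and> norm (F K m - f m) \<le> C / (real m ^ e * real (Suc K - m))"
    using assms unfolding approx_def by (elim exE conjE)
  then show thesis by (intro that[of C]) auto
qed

lemma approx_add:
  assumes "approx e F f" "approx e G g"
  shows "approx e (\<lambda>K m. F K m + G K m) (\<lambda>m. f m + g m)"
proof -
  obtain C where C: "C \<ge> 0" "\<And>m. 1 \<le> m \<Longrightarrow> norm (f m) \<le> C / real m ^ e"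
    "\<And>K m. 1 \<le> m \<Longrightarrow> m \<le> K \<Longrightarrow> norm (F K m - f m) \<le> C / (real m ^ e * real (Suc K - m))"
    using approxE[OF assms(1)] by blast
  obtain D where D: "D \<ge> 0" "\<And>m. 1 \<le> m \<Longrightarrow> norm (g m) \<le> D / real m ^ e"
    "\<And>K m. 1 \<le> m \<Longrightarrow> m \<le> K \<Longrightarrow> norm (G K m - g m) \<le> D / (real m ^ e * real (Suc K - m))"
    using approxE[OF assms(2)] by blast
  show ?thesis
  proof (rule approxI[where C = "C + D" and D = "C + D"])
    fix m :: nat assume m: "1 \<le> m"
    show "norm (f m + g m) \<le> (C + D) / real m ^ e"
      using norm_triangle_ineq[of "f m" "g m"] C(2)[OF m] D(2)[OF m] by (simp add: add_divide_distrib)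
  next
    fix K m :: nat assume m: "1 \<le> m" "m \<le> K"
    have "F K m + G K m - (f m + g m) = (F K m - f m) + (G K m - g m)" by simp
    then show "norm (F K m + G K m - (f m + g m)) \<le> (C + D) / (real m ^ e * real (Suc K - m))"
      using norm_triangle_mono[OF C(3)[OF m] D(3)[OF m]]
      by (simp only: add_divide_distrib)
  qed
qed

text \<open>From FG - fg = (F - f) G + f (G - g): each summand contains one error and one bounded
  factor, so the exponents add and the distance to the cutoff appears once.\<close>

lemma approx_mult:
  assumes "approx e F f" "approx e' G g"
  shows "approx (e + e') (\<lambda>K m. F K m * G K m) (\<lambda>m. f m * g m)"
proof -
  obtain C where C: "C \<ge> 0" "\<And>m. 1 \<le> m \<Longrightarrow> norm (f m) \<le> C / real m ^ e"
    "\<And>K m. 1 \<le> m \<Longrightarrow> m \<le> K \<Longrightarrow> norm (F K m - f m) \<le> C / (real m ^ e * real (Suc K - m))"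
    using approxE[OF assms(1)] by blast
  obtain D where D: "D \<ge> 0" "\<And>m. 1 \<le> m \<Longrightarrow> norm (g m) \<le> D / real m ^ e'"
    "\<And>K m. 1 \<le> m \<Longrightarrow> m \<le> K \<Longrightarrow> norm (G K m - g m) \<le> D / (real m ^ e' * real (Suc K - m))"
    using approxE[OF assms(2)] by blast
  show ?thesis
  proof (rule approxI[where C = "C * D" and D = "2 * C * D + C * D"])
    fix m :: nat assume m: "1 \<le> m"
    have "norm (f m) * norm (g m) \<le> (C / real m ^ e) * (D / real m ^ e')"
      using C D m by (intro mult_mono) auto
    then show "norm (f m * g m) \<le> C * D / real m ^ (e + e')"
      by (simp add: norm_mult power_add)
  next
    fix K m :: nat assume m: "1 \<le> m" "m \<le> K"
    define X where "X = real (Suc K - m)"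
    have X: "X \<ge> 1" using m by (simp add: X_def)
    \<comment> \<open>The error of \<open>G\<close> is at most D / m^e' because K + 1 - m \<ge> 1;
      together with the bound for \<open>g\<close> this gives the factor 2.\<close>
    have gb: "norm (G K m) \<le> 2 * D / real m ^ e'"
    proof -
      have "norm (G K m) \<le> norm (g m) + norm (G K m - g m)"
        using norm_triangle_sub by blast
      also have "\<dots> \<le> D / real m ^ e' + D / (real m ^ e' * X)"
        using D(2)[OF m(1)] D(3)[OF m] by (simp add: X_def)
      also have "D / (real m ^ e' * X) \<le> D / real m ^ e'"
        using X D(1) m by (intro divide_left_mono) auto
      finally show ?thesis by simp
    qed
    have "F K m * G K m - f m * g m = (F K m - f m) * G K m + f m * (G K m - g m)"
      by (simp add: algebra_simps)
    also have "norm \<dots> \<le> norm (F K m - f m) * norm (G K m) + norm (f m) * norm (G K m - g m)"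
      using norm_triangle_ineq[of "(F K m - f m) * G K m" "f m * (G K m - g m)"] by (simp add: norm_mult)
    also have "\<dots> \<le> C / (real m ^ e * X) * (2 * D / real m ^ e')
        + C / real m ^ e * (D / (real m ^ e' * X))"
      using C D gb m X by (intro add_mono mult_mono) (auto simp: X_def)
    also have "\<dots> = (2 * C * D + C * D) / (real m ^ (e + e') * X)"
      by (simp add: power_add field_simps)
    finally show "norm (F K m * G K m - f m * g m)
        \<le> (2 * C * D + C * D) / (real m ^ (e + e') * real (Suc K - m))" by (simp add: X_def)
  qed
qed

lemma approx_self:
  assumes "\<And>m::nat. 1 \<le> m \<Longrightarrow> norm (f m) \<le> C / real m ^ e"
  shows "approx e (\<lambda>K. f) f"
  by (rule approxI[where C = C and D = 0]) (simp_all add: assms)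

lemma approx_const: "approx 0 (\<lambda>K m. c) (\<lambda>m. c)"
  by (rule approx_self[where C = "norm c"]) simp

lemma approx_scale:
  "approx e F f \<Longrightarrow> approx e (\<lambda>K m. c * F K m) (\<lambda>m. c * f m)"
  using approx_mult[OF approx_const] by force

lemma approx_sum:
  assumes "finite I" "\<And>i. i \<in> I \<Longrightarrow> approx e (F i) (f i)"
  shows "approx e (\<lambda>K m. \<Sum>i\<in>I. F i K m) (\<lambda>m. \<Sum>i\<in>I. f i m)"
  using assms
proof (induction I)
  case empty
  show ?case using approx_self[where C = 0 and f = "\<lambda>_. 0" and e = e] by simp
next
  case (insert i I)
  have "approx e (\<lambda>K m. F i K m + (\<Sum>i\<in>I. F i K m)) (\<lambda>m. f i m + (\<Sum>i\<in>I. f i m))"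
    using insert by (intro approx_add) simp_all
  then show ?case using insert by simp
qed

lemma approx_prod:
  assumes "\<And>i. i \<in> {1..r::nat} \<Longrightarrow> approx 0 (F i) (f i)"
  shows "approx 0 (\<lambda>K m. \<Prod>i=1..r. F i K m) (\<lambda>m. \<Prod>i=1..r. f i m)"
  using assms
proof (induction r)
  case 0
  show ?case using approx_const[of 1] by simp
next
  case (Suc r)
  show ?case using approx_mult[OF Suc.IH Suc.prems[of "Suc r"]] Suc.prems by simp
qed

text \<open>Partial fractions give 1/(m (K+1-m)) = (1/m + 1/(K+1-m))/(K+1), and reflecting m turns
  the second sum into the first. The total is twice the harmonic number of K over K + 1.\<close>

lemma harmonic_over_n: "(\<lambda>K. \<Sum>m=1..K. 1 / (real m * real (Suc K - m))) \<longlonglongrightarrow> 0"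
proof -
  have eq: "(\<Sum>m=1..K. 1 / (real m * real (Suc K - m))) = 2 * (harm K / real (Suc K))" for K
  proof -
    have "(\<Sum>m=1..K. 1 / (real m * real (Suc K - m)))
        = (\<Sum>m=1..K. (1 / real m + 1 / real (Suc K - m)) / real (Suc K))"
    proof (rule sum.cong)
      fix m assume "m \<in> {1..K}"
      then have "real (Suc K) = real m + real (Suc K - m)" "real m > 0" "real (Suc K - m) > 0" by auto
      moreover have "1 / (u * w) = (1 / u + 1 / w) / (u + w)" if "u > 0" "w > 0" for u w :: real
        using that add_pos_pos[OF that] by (simp add: divide_simps)
      ultimately show "1 / (real m * real (Suc K - m)) = (1 / real m + 1 / real (Suc K - m)) / real (Suc K)"
        by metis
    qed simp
    also have "\<dots> = ((\<Sum>m=1..K. 1 / real m) + (\<Sum>m=1..K. 1 / real (Suc K - m))) / real (Suc K)"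
      by (simp add: sum_divide_distrib[symmetric] sum.distrib)
    also have "(\<Sum>m=1..K. 1 / real (Suc K - m)) = (\<Sum>m=1..K. 1 / real m)"
      by (rule sum.reindex_bij_witness[of _ "\<lambda>m. Suc K - m" "\<lambda>m. Suc K - m"]) auto
    finally show ?thesis by (simp add: harm_def inverse_eq_divide)
  qed
  have "(\<lambda>K. harm K / real (Suc K)) \<longlonglongrightarrow> 0"
  proof -
    have a: "(\<lambda>n. harm n - ln (real n)) \<longlonglongrightarrow> (euler_mascheroni::real)"
      by (rule euler_mascheroni_LIMSEQ)
    \<comment> \<open>Splitting off ln n leaves a convergent sequence divided by n + 1, while (ln
      n)/n tends to 0.\<close>
    have "(\<lambda>n. (harm n - ln (real n)) * (1 / real (Suc n)) + ln (real n) / real n * (real n / real (Suc n)))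
        \<longlonglongrightarrow> euler_mascheroni * 0 + 0 * 1"
      by (intro tendsto_intros a const_over_Suc_tendsto lim_ln_over_n LIMSEQ_n_over_Suc_n)
    then have "(\<lambda>n. (harm n - ln (real n)) * (1 / real (Suc n)) + ln (real n) / real n * (real n / real (Suc n)))
        \<longlonglongrightarrow> 0" by simp
    then show ?thesis
    proof (rule Lim_transform_eventually)
      show "\<forall>\<^sub>F n in sequentially. (harm n - ln (real n)) * (1 / real (Suc n))
          + ln (real n) / real n * (real n / real (Suc n)) = harm n / real (Suc n)"
        using eventually_gt_at_top[of 0] by eventually_elim (simp add: divide_simps)
    qed
  qed
  from tendsto_mult[OF tendsto_const[of 2] this] show ?thesis by (simp only: eq mult_zero_right)
qed

text \<open>With exponent 1 the accumulated error is at most a constant times the sum in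
  \<open>harmonic_over_n\<close>. Only ordinary convergence of the limiting series enters, so
  conditionally convergent series are covered.\<close>

lemma approx_sums:
  assumes "approx 1 F f" "summable (\<lambda>n. f (Suc n))"
  shows "(\<lambda>K. \<Sum>m=1..K. F K m) \<longlonglongrightarrow> (\<Sum>n. f (Suc n))"
proof -
  obtain C where C: "C \<ge> 0" "\<And>m. 1 \<le> m \<Longrightarrow> norm (f m) \<le> C / real m ^ 1"
    "\<And>K m. 1 \<le> m \<Longrightarrow> m \<le> K \<Longrightarrow> norm (F K m - f m) \<le> C / (real m ^ 1 * real (Suc K - m))"
    using approxE[OF assms(1)] by blast
  have "(\<lambda>K. (\<Sum>m=1..K. F K m) - (\<Sum>m=1..K. f m)) \<longlonglongrightarrow> 0"
  proof (rule Lim_null_comparison[OF always_eventually])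
    show "(\<lambda>K. C * (\<Sum>m=1..K. 1 / (real m * real (Suc K - m)))) \<longlonglongrightarrow> 0"
      using tendsto_mult[OF tendsto_const[of C] harmonic_over_n] by simp
    show "\<forall>K. norm ((\<Sum>m=1..K. F K m) - (\<Sum>m=1..K. f m))
        \<le> C * (\<Sum>m=1..K. 1 / (real m * real (Suc K - m)))"
    proof
      fix K
      have "norm (\<Sum>m=1..K. F K m - f m) \<le> (\<Sum>m=1..K. C * (1 / (real m * real (Suc K - m))))"
        by (rule sum_norm_le) (use C(3) in auto)
      then show "norm ((\<Sum>m=1..K. F K m) - (\<Sum>m=1..K. f m))
        \<le> C * (\<Sum>m=1..K. 1 / (real m * real (Suc K - m)))"
        by (simp add: sum_subtractf sum_distrib_left)
    qed
  qed
  moreover have "(\<lambda>K. \<Sum>m=1..K. f m) \<longlonglongrightarrow> (\<Sum>n. f (Suc n))"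
  proof -
    have "(\<Sum>m=1..K. f m) = (\<Sum>n<K. f (Suc n))" for K
      by (induction K) auto
    then show ?thesis using summable_LIMSEQ[OF assms(2)] by simp
  qed
  ultimately show ?thesis using tendsto_add by fastforce
qed

text \<open>A partial sum of at least K - m terms misses its limit by O(1/(K+1-m)), which is exactly
  the error that \<open>approx\<close> permits. The lengths that occur are K + m, K + 1 - m and K -
  m.\<close>

lemma approx_zeta_tail:
  assumes "root_of_unity w" "p \<ge> 1" "(p, w) \<noteq> (1, 1)" "nonpole b"
    and "\<And>K m. 1 \<le> m \<Longrightarrow> m \<le> K \<Longrightarrow> N K m \<ge> K - m"
  shows "approx 0 (\<lambda>K m. zeta_partial (N K m) p w b) (\<lambda>m. Li p w (b + 1))"
proof -
  obtain C where C: "C \<ge> 0" "\<And>N. norm (zeta_partial N p w b - Li p w (b + 1)) \<le> C / real (Suc N)"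
    using zeta_partial_Li[OF assms(1-4)] by blast
  show ?thesis
  proof (rule approxI[where C = "norm (Li p w (b + 1))" and D = C])
    fix K m :: nat assume m: "1 \<le> m" "m \<le> K"
    have "norm (zeta_partial (N K m) p w b - Li p w (b + 1)) \<le> C / real (Suc (N K m))" by (rule C)
    also have "\<dots> \<le> C / real (Suc K - m)"
      using assms(5)[OF m] m C(1) by (intro divide_left_mono) (auto simp del: of_nat_Suc)
    finally show "norm (zeta_partial (N K m) p w b - Li p w (b + 1)) \<le> C / (real m ^ 0 * real (Suc K - m))"
      by simp
  qed simp
qed

lemma approx_zeta:
  assumes "root_of_unity w" "p \<ge> 1" "(p, w) \<noteq> (1, 1)" "nonpole b"
  shows "approx 0 (\<lambda>K m. zeta_partial m p w b) (\<lambda>m. zeta_partial m p w b)"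
proof -
  obtain C where C: "\<And>N. norm (zeta_partial N p w b) \<le> C"
    using zeta_partial_bounded[OF assms] by blast
  show ?thesis by (rule approx_self[where C = C]) (use C in simp)
qed

lemma approx_power:
  assumes "norm w = 1" "nonpole b" "q \<ge> e"
  shows "approx e (\<lambda>K m. w ^ m / (of_nat m + b) ^ q) (\<lambda>m. w ^ m / (of_nat m + b) ^ q)"
proof -
  obtain C where C: "C > 0" "\<And>n p. n \<ge> 1 \<Longrightarrow> norm (1 / (of_nat n + b) ^ p) \<le> C ^ p / real n ^ p"
    using nonpole_bound[OF assms(2)] by blast
  show ?thesis
  proof (rule approx_self[where C = "C ^ q"])
    fix m :: nat assume m: "1 \<le> m"
    have "norm (w ^ m / (of_nat m + b) ^ q) = norm (1 / (of_nat m + b) ^ q)"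
      by (simp add: norm_divide norm_power assms)
    also have "\<dots> \<le> C ^ q / real m ^ q" using C(2)[OF m] .
    also have "\<dots> \<le> C ^ q / real m ^ e"
      using C m assms(3) by (intro divide_left_mono power_increasing) auto
    finally show "norm (w ^ m / (of_nat m + b) ^ q) \<le> C ^ q / real m ^ e" .
  qed
qed

subsection \<open>The ring of coefficients\<close>

lemma rat_adjoin_0: "0 \<in> rat_adjoin H"
  using rat_adjoin.add[OF rat_adjoin.one rat_adjoin.uminus[OF rat_adjoin.one]] by simp

lemma rat_adjoin_of_nat: "of_nat n \<in> rat_adjoin H"
  by (induction n) (auto intro: rat_adjoin_0 rat_adjoin.add rat_adjoin.one)

lemma rat_adjoin_inverse: "h \<in> rat_adjoin H \<Longrightarrow> inverse h \<in> rat_adjoin H"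
  by (cases "h = 0") (auto intro: rat_adjoin.inverse)

lemma rat_adjoin_power: "h \<in> rat_adjoin H \<Longrightarrow> h ^ n \<in> rat_adjoin H"
  by (induction n) (auto intro: rat_adjoin.mult rat_adjoin.one)

lemma rat_adjoin_minus_one_power: "(- 1) ^ n \<in> rat_adjoin H"
  by (intro rat_adjoin_power rat_adjoin.uminus rat_adjoin.one)

lemma linear_combinations_0: "0 \<in> linear_combinations K P"
  unfolding linear_combinations_def by (auto intro!: exI[of _ "0::nat"])

lemma linear_combinations_single: "c \<in> K \<Longrightarrow> t \<in> P \<Longrightarrow> c * t \<in> linear_combinations K P"
  unfolding linear_combinations_def
  by (intro CollectI exI[of _ 1] exI[of _ "\<lambda>_. c"] exI[of _ "\<lambda>_. t"]) simp

lemma linear_combinations_add: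
  assumes "f \<in> linear_combinations K P" "g \<in> linear_combinations K P"
  shows "f + g \<in> linear_combinations K P"
proof -
  obtain M :: nat and c t where f: "f = (\<Sum>i<M. c i * t i)" "\<forall>i<M. c i \<in> K \<and> t i \<in> P"
    using assms(1) by (auto simp: linear_combinations_def)
  obtain N :: nat and d u where g: "g = (\<Sum>i<N. d i * u i)" "\<forall>i<N. d i \<in> K \<and> u i \<in> P"
    using assms(2) by (auto simp: linear_combinations_def)
  define c' where "c' i = (if i < M then c i else d (i - M))" for i
  define t' where "t' i = (if i < M then t i else u (i - M))" for i
  have "(\<Sum>i<M + n. c' i * t' i) = f + (\<Sum>i<n. d i * u i)" for n
  proof (induction n)
    case 0
    show ?case unfolding f by (simp add: c'_def t'_def)
  qed (simp add: c'_def t'_def)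
  then have "(\<Sum>i<M + N. c' i * t' i) = f + g" unfolding g .
  moreover have "\<forall>i<M + N. c' i \<in> K \<and> t' i \<in> P"
    using f g by (auto simp: c'_def t'_def)
  ultimately show ?thesis unfolding linear_combinations_def
    by (intro CollectI exI[of _ "M + N"] exI[of _ c'] exI[of _ t']) simp
qed

lemma linear_combinations_induct [consumes 1, case_names zero add]:
  assumes "s \<in> linear_combinations K P" "Q 0"
    and "\<And>s c t. Q s \<Longrightarrow> c \<in> K \<Longrightarrow> t \<in> P \<Longrightarrow> Q (s + c * t)"
  shows "Q s"
proof -
  obtain M :: nat and c t where "s = (\<Sum>i<M. c i * t i)" "\<forall>i<M. c i \<in> K \<and> t i \<in> P"
    using assms(1) by (auto simp: linear_combinations_def)
  moreover from this(2) have "Q (\<Sum>i<M. c i * t i)"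
    by (induction M) (auto intro: assms)
  ultimately show ?thesis by simp
qed

section \<open>Combinations of products, with and without constant terms\<close>

definition comb_ideal :: "complex set \<Rightarrow> complex set \<Rightarrow> complex set" where
  "comb_ideal H G = linear_combinations (rat_adjoin H) (finite_products G)"

text \<open>\<open>finite_products\<close> excludes the empty product, so \<open>comb_ideal\<close> contains no constants;
  \<open>comb_ring\<close> adjoins them, and \<open>comb_ideal\<close> is an ideal of it.\<close>

definition comb_ring :: "complex set \<Rightarrow> complex set \<Rightarrow> complex set" where
  "comb_ring H G = {c + s | c s. c \<in> rat_adjoin H \<and> s \<in> comb_ideal H G}"

lemma finite_products_mult:
  "f \<in> finite_products G \<Longrightarrow> g \<in> finite_products G \<Longrightarrow> f * g \<in> finite_products G"
proof -
  assume "f \<in> finite_products G" "g \<in> finite_products G"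
  then obtain fs gs where "f = prod_list fs" "fs \<noteq> []" "set fs \<subseteq> G" "g = prod_list gs" "set gs \<subseteq> G"
    unfolding finite_products_def by blast
  then show ?thesis unfolding finite_products_def by (intro CollectI exI[of _ "fs @ gs"]) auto
qed

lemma comb_ideal_0: "0 \<in> comb_ideal H G"
  unfolding comb_ideal_def by (rule linear_combinations_0)

lemma comb_ideal_add: "s \<in> comb_ideal H G \<Longrightarrow> t \<in> comb_ideal H G \<Longrightarrow> s + t \<in> comb_ideal H G"
  unfolding comb_ideal_def by (rule linear_combinations_add)

lemma comb_ideal_scale:
  assumes "c \<in> rat_adjoin H" "s \<in> comb_ideal H G"
  shows "c * s \<in> comb_ideal H G"
  using assms(2) unfolding comb_ideal_def
proof (induction rule: linear_combinations_induct)
  case (add s d t)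
  have "(c * d) * t \<in> linear_combinations (rat_adjoin H) (finite_products G)"
    using add assms(1) by (intro linear_combinations_single rat_adjoin.mult)
  from linear_combinations_add[OF add(1) this] show ?case by (simp add: algebra_simps)
qed (simp add: linear_combinations_0)

lemma comb_ideal_mult:
  assumes "s \<in> comb_ideal H G" "t \<in> comb_ideal H G"
  shows "s * t \<in> comb_ideal H G"
  using assms(1) unfolding comb_ideal_def
proof (induction rule: linear_combinations_induct)
  case (add s c f)
  have "f * t \<in> comb_ideal H G"
    using assms(2) unfolding comb_ideal_def
  proof (induction rule: linear_combinations_induct)
    case (add t d g)
    have "d * (f * g) \<in> linear_combinations (rat_adjoin H) (finite_products G)"
      using add \<open>f \<in> finite_products G\<close> by (intro linear_combinations_single finite_products_mult)
    from linear_combinations_add[OF add(1) this] show ?case by (simp add: algebra_simps)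
  qed (simp add: linear_combinations_0)
  from comb_ideal_scale[OF add(2) this] add(1) linear_combinations_add show ?case
    by (auto simp: comb_ideal_def algebra_simps)
qed (simp add: linear_combinations_0)

lemma comb_ideal_gen: "g \<in> G \<Longrightarrow> g \<in> comb_ideal H G"
proof -
  assume "g \<in> G"
  then have "g \<in> finite_products G"
    unfolding finite_products_def by (intro CollectI exI[of _ "[g]"]) simp
  from linear_combinations_single[OF rat_adjoin.one this] show ?thesis by (simp add: comb_ideal_def)
qed

lemma comb_ideal_sum: "(\<And>i. i \<in> S \<Longrightarrow> f i \<in> comb_ideal H G) \<Longrightarrow> (\<Sum>i\<in>S. f i) \<in> comb_ideal H G"
  by (induction S rule: infinite_finite_induct) (auto intro: comb_ideal_add comb_ideal_0)

lemma comb_ring_scalar: "c \<in> rat_adjoin H \<Longrightarrow> c \<in> comb_ring H G"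
  unfolding comb_ring_def by (intro CollectI exI[of _ c] exI[of _ 0]) (auto intro: comb_ideal_0)

lemma comb_ring_ideal: "s \<in> comb_ideal H G \<Longrightarrow> s \<in> comb_ring H G"
  unfolding comb_ring_def by (intro CollectI exI[of _ 0] exI[of _ s]) (auto intro: rat_adjoin_0)

lemma comb_ring_add: "s \<in> comb_ring H G \<Longrightarrow> t \<in> comb_ring H G \<Longrightarrow> s + t \<in> comb_ring H G"
proof -
  assume "s \<in> comb_ring H G" "t \<in> comb_ring H G"
  then obtain c d s' t' where *: "c \<in> rat_adjoin H" "s' \<in> comb_ideal H G" "s = c + s'"
    "d \<in> rat_adjoin H" "t' \<in> comb_ideal H G" "t = d + t'" unfolding comb_ring_def by blast
  then have "s + t = (c + d) + (s' + t')" by simp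
  then show ?thesis using * rat_adjoin.add comb_ideal_add unfolding comb_ring_def by blast
qed

lemma comb_ideal_ring_mult: "s \<in> comb_ring H G \<Longrightarrow> t \<in> comb_ideal H G \<Longrightarrow> s * t \<in> comb_ideal H G"
  by (auto simp: comb_ring_def distrib_right intro!: comb_ideal_add)
    (simp_all add: comb_ideal_scale comb_ideal_mult)

lemma comb_ring_mult: "s \<in> comb_ring H G \<Longrightarrow> t \<in> comb_ring H G \<Longrightarrow> s * t \<in> comb_ring H G"
proof -
  assume s: "s \<in> comb_ring H G" and t: "t \<in> comb_ring H G"
  obtain c s' where c: "c \<in> rat_adjoin H" "s' \<in> comb_ideal H G" "s = c + s'"
    using s unfolding comb_ring_def by blast
  obtain d t' where d: "d \<in> rat_adjoin H" "t' \<in> comb_ideal H G" "t = d + t'"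
    using t unfolding comb_ring_def by blast
  have "s * t = c * d + (d * s' + s * t')" using c d by (simp add: algebra_simps)
  moreover have "c * d \<in> comb_ring H G"
    using c(1) d(1) by (intro comb_ring_scalar rat_adjoin.mult)
  moreover have "d * s' + s * t' \<in> comb_ring H G"
    by (intro comb_ring_ideal comb_ideal_add comb_ideal_scale comb_ideal_ring_mult c d s)
  ultimately show ?thesis using comb_ring_add by simp
qed

lemma comb_ring_sum: "(\<And>i. i \<in> S \<Longrightarrow> f i \<in> comb_ring H G) \<Longrightarrow> (\<Sum>i\<in>S. f i) \<in> comb_ring H G"
  by (induction S rule: infinite_finite_induct)
    (auto intro: comb_ring_add comb_ring_scalar rat_adjoin_0)

subsection \<open>Linear combinations of Euler sums\<close>

definition euler_monomial ::
  "complex \<Rightarrow> nat \<Rightarrow> (nat \<Rightarrow> nat) \<Rightarrow> nat \<Rightarrow> (nat \<Rightarrow> complex) \<Rightarrow> complex \<Rightarrow> nat \<Rightarrow> complex" where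
  "euler_monomial b k p q u v n = (\<Prod>j=1..k. zeta_partial n (p j) (u j) b) / (of_nat n + b) ^ q * v ^ n"

text \<open>Excluding (1,1) for the inner pairs as well makes all inner partial sums converge, hence
  stay bounded.\<close>

definition convergent_params ::
  "nat \<Rightarrow> (nat \<Rightarrow> nat) \<Rightarrow> nat \<Rightarrow> (nat \<Rightarrow> complex) \<Rightarrow> complex \<Rightarrow> bool" where
  "convergent_params k p q u v \<longleftrightarrow>
     euler_sum_params k p q u v \<and> (\<forall>j\<in>{1..k}. (p j, u j) \<noteq> (1, 1))"

text \<open>Combinations of summands, kept as sequences in n so that they can still be multiplied by
  further factors depending on n; summation comes last. The bound \<open>d\<close> on the degree is
  strict, so d = r means degree less than r.\<close>

inductive euler_comb :: "complex set \<Rightarrow> complex \<Rightarrow> nat \<Rightarrow> (nat \<Rightarrow> complex) \<Rightarrow> bool" for A b d where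
  zero: "euler_comb A b d (\<lambda>_. 0)"
| step: "euler_comb A b d f \<Longrightarrow> c \<in> A \<Longrightarrow> k < d \<Longrightarrow> convergent_params k p q u v
    \<Longrightarrow> euler_comb A b d (\<lambda>n. f n + c * euler_monomial b k p q u v n)"

lemma euler_comb_mono: "euler_comb A b d f \<Longrightarrow> d \<le> d' \<Longrightarrow> euler_comb A b d' f"
  by (induction rule: euler_comb.induct) (auto intro: euler_comb.intros)

lemma euler_comb_add:
  assumes "euler_comb A b d f" "euler_comb A b d g"
  shows "euler_comb A b d (\<lambda>n. f n + g n)"
  using assms(2,1)
proof (induction rule: euler_comb.induct)
  case (step g c k p q u v)
  then have "euler_comb A b d (\<lambda>n. (f n + g n) + c * euler_monomial b k p q u v n)"
    by (intro euler_comb.step)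
  then show ?case by (simp add: add.assoc)
qed simp

lemma euler_comb_sum:
  assumes "\<And>i. i \<in> S \<Longrightarrow> euler_comb A b d (f i)"
  shows "euler_comb A b d (\<lambda>n. \<Sum>i\<in>S. f i n)"
  using assms
proof (induction S rule: infinite_finite_induct)
  case (insert i S)
  have "euler_comb A b d (\<lambda>n. f i n + (\<Sum>i\<in>S. f i n))" using insert by (intro euler_comb_add) auto
  then show ?case using insert by simp
qed (simp_all add: euler_comb.zero)

lemma euler_comb_scale:
  assumes "euler_comb (comb_ring H G) b d f" "e \<in> comb_ring H G"
  shows "euler_comb (comb_ring H G) b d (\<lambda>n. e * f n)"
  using assms(1)
proof (induction rule: euler_comb.induct)
  case (step f c k p q u v)
  then have "euler_comb (comb_ring H G) b d (\<lambda>n. e * f n + (e * c) * euler_monomial b k p q u v n)"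
    by (intro euler_comb.step comb_ring_mult assms(2))
  then show ?case by (simp add: algebra_simps)
qed (simp add: euler_comb.zero)

text \<open>The new partial sum becomes the factor number \<open>Suc k\<close> of each monomial,
  which raises the degree by one.\<close>

lemma euler_comb_zeta:
  assumes "euler_comb A b d f" "root_of_unity w" "m \<ge> 1" "(m, w) \<noteq> (1, 1)"
  shows "euler_comb A b (Suc d) (\<lambda>n. f n * zeta_partial n m w b)"
  using assms(1)
proof (induction rule: euler_comb.induct)
  case (step f c k p q u v)
  have "euler_monomial b k p q u v n * zeta_partial n m w b
      = euler_monomial b (Suc k) (p(Suc k := m)) q (u(Suc k := w)) v n" for n
    by (simp add: euler_monomial_def)
  moreover have "convergent_params (Suc k) (p(Suc k := m)) q (u(Suc k := w)) v"
    using step assms by (auto simp: convergent_params_def euler_sum_params_def)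
  ultimately show ?case
    using euler_comb.step[OF step.IH \<open>c \<in> A\<close>, of "Suc k"] \<open>k < d\<close> by (simp add: distrib_right mult.assoc)
qed (simp add: euler_comb.zero)

text \<open>Only the outer exponent and the outer root of unity change, so the degree stays. The new
  exponent is at least 2, hence the excluded pair (1,1) cannot arise.\<close>

lemma euler_comb_power:
  assumes "euler_comb A b d f" "root_of_unity w" "m \<ge> 1"
  shows "euler_comb A b d (\<lambda>n. f n * (w ^ n / (of_nat n + b) ^ m))"
  using assms(1)
proof (induction rule: euler_comb.induct)
  case (step f c k p q u v)
  have "(f n + c * euler_monomial b k p q u v n) * (w ^ n / (of_nat n + b) ^ m)
      = f n * (w ^ n / (of_nat n + b) ^ m) + c * euler_monomial b k p (q + m) u (v * w) n" for n
    by (simp add: euler_monomial_def power_add power_mult_distrib distrib_right add_divide_distrib)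
  moreover have "convergent_params k p (q + m) u (v * w)"
    using step assms by (auto simp: convergent_params_def euler_sum_params_def intro: root_of_unity_mult)
  ultimately show ?case
    using euler_comb.step[OF step.IH \<open>c \<in> A\<close> \<open>k < d\<close>] by simp
qed (simp add: euler_comb.zero)

lemma euler_comb_monomial:
  assumes "convergent_params k p q u v" "k < d" "1 \<in> A"
  shows "euler_comb A b d (euler_monomial b k p q u v)"
  using euler_comb.step[OF euler_comb.zero assms(3,2,1)] by simp

lemma approx_monomial:
  assumes "convergent_params k p q u v" "nonpole b"
  shows "approx 1 (\<lambda>K. euler_monomial b k p q u v) (euler_monomial b k p q u v)"
proof -
  have "approx (0 + 1) (\<lambda>K m. (\<Prod>j=1..k. zeta_partial m (p j) (u j) b) * (v ^ m / (of_nat m + b) ^ q))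
      (\<lambda>m. (\<Prod>j=1..k. zeta_partial m (p j) (u j) b) * (v ^ m / (of_nat m + b) ^ q))"
    using assms by (intro approx_mult approx_prod approx_zeta approx_power)
      (auto simp: convergent_params_def euler_sum_params_def root_of_unity_norm)
  then show ?thesis by (simp add: euler_monomial_def[abs_def])
qed

text \<open>Induction on the degree: the last partial sum is its limit plus an error O(1/n). The
  error times the remaining monomial is O(1/n^2), and the limit times that monomial is summable by
  the induction hypothesis.\<close>

lemma summable_monomial:
  assumes "convergent_params k p q u v" "nonpole b"
  shows "summable (\<lambda>n. euler_monomial b k p q u v (Suc n))"
  using assms(1)
proof (induction k)
  case 0
  have "root_of_unity v" "q \<ge> 1" "(q, v) \<noteq> (1, 1)"
    using 0 by (auto simp: convergent_params_def euler_sum_params_def)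
  then have "(\<lambda>N. \<Sum>n<N. v ^ Suc n / (of_nat (Suc n) + b) ^ q) \<longlonglongrightarrow> Li q v (b + 1)"
    using zeta_partial_tendsto[OF _ _ _ assms(2)] by (simp add: zeta_partial_eq_sum)
  then have "summable (\<lambda>n. v ^ Suc n / (of_nat (Suc n) + b) ^ q)"
    by (auto simp: summable_def sums_def)
  then show ?case by (simp add: euler_monomial_def)
next
  case (Suc k)
  then have k: "convergent_params k p q u v"
    by (auto simp: convergent_params_def euler_sum_params_def)
  let ?w = "u (Suc k)" and ?m = "p (Suc k)" and ?f = "euler_monomial b k p q u v"
  let ?L = "Li ?m ?w (b + 1)"
  have *: "root_of_unity ?w" "?m \<ge> 1" "(?m, ?w) \<noteq> (1, 1)"
    using Suc.prems by (auto simp: convergent_params_def euler_sum_params_def)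
  obtain C where C: "C \<ge> 0" "\<And>m. 1 \<le> m \<Longrightarrow> norm (?f m) \<le> C / real m ^ 1"
    using approxE[OF approx_monomial[OF k assms(2)]] by metis
  obtain D where D: "D \<ge> 0" "\<And>N. norm (zeta_partial N ?m ?w b - ?L) \<le> D / real (Suc N)"
    using zeta_partial_Li[OF * assms(2)] by blast
  have "norm (?f (Suc n) * (zeta_partial (Suc n) ?m ?w b - ?L)) \<le> C * D / real (Suc n) ^ 2" for n
  proof -
    have "norm (zeta_partial (Suc n) ?m ?w b - ?L) \<le> D / real (Suc (Suc n))" by (rule D)
    also have "\<dots> \<le> D / real (Suc n)" using D by (intro divide_left_mono) auto
    finally have "norm (?f (Suc n)) * norm (zeta_partial (Suc n) ?m ?w b - ?L) \<le> C / real (Suc n) * (D / real (Suc n))"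
      using C(2)[of "Suc n"] C(1) by (intro mult_mono) auto
    then show ?thesis by (simp add: norm_mult power2_eq_square)
  qed
  from summable_add[OF inverse_square_tail(1)[OF this] summable_mult[OF Suc.IH[OF k], of ?L]]
  have "summable (\<lambda>n. ?f (Suc n) * zeta_partial (Suc n) ?m ?w b)" by (simp add: algebra_simps)
  then show ?case by (simp add: euler_monomial_def ac_simps)
qed

lemma euler_comb_summable:
  assumes "euler_comb A b d f" "nonpole b"
  shows "summable (\<lambda>n. f (Suc n))"
  using assms(1)
  by (induction rule: euler_comb.induct)
    (auto intro!: summable_add summable_mult summable_monomial assms(2))

text \<open>Each monomial sums to a generator, and a ring element times a generator lies in the
  ideal; this is why coefficients with constant terms are harmless here.\<close>

lemma euler_comb_suminf:
  assumes "euler_comb (comb_ring H G) b d f" "nonpole b"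
    and "\<And>k p q u v. k < d \<Longrightarrow> euler_sum_params k p q u v \<Longrightarrow> euler_S b k p q u v \<in> G"
  shows "(\<Sum>n. f (Suc n)) \<in> comb_ideal H G"
  using assms(1)
proof (induction rule: euler_comb.induct)
  case (step f c k p q u v)
  note s = summable_monomial[OF \<open>convergent_params k p q u v\<close> assms(2)]
  have "(\<Sum>n. f (Suc n) + c * euler_monomial b k p q u v (Suc n))
      = (\<Sum>n. f (Suc n)) + c * euler_S b k p q u v"
    using suminf_add[OF euler_comb_summable[OF step.hyps(1) assms(2)] summable_mult[OF s, of c]]
      suminf_mult[OF s, of c] by (simp add: euler_S_def euler_monomial_def)
  moreover have "c * euler_S b k p q u v \<in> comb_ideal H G"
    using step.hyps assms(3) by (intro comb_ideal_ring_mult comb_ideal_gen) (auto simp: convergent_params_def)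
  ultimately show ?case using step.IH by (simp add: comb_ideal_add)
qed (simp add: comb_ideal_0)

subsection \<open>Partial fractions through formal Laurent series\<close>

text \<open>The function s + k at s = X - l is \<open>fls_lin\<close> of k - l. Its powers have
  power series as inverses unless k = l, where it is X itself.\<close>

definition fls_lin :: "complex \<Rightarrow> complex fls" where
  "fls_lin c = fls_X + fls_const c"

lemma fls_lin_nonzero: "fls_lin c \<noteq> 0"
proof
  assume "fls_lin c = 0"
  then have "fls_nth (fls_lin c) 1 = 0" by simp
  then show False by (simp add: fls_lin_def)
qed

text \<open>The pair \<open>(z, F)\<close> records the values of one rational function with poles of order
  at most \<open>M\<close> at \<open>0, -1, \<dots>, -K\<close> in two fields: at the complex number \<open>s\<close>, and at the
  elements \<open>X - l\<close> of the field of formal Laurent series. The latter are the expansions at the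
  points \<open>-l\<close>.\<close>

inductive pfrac :: "complex \<Rightarrow> nat \<Rightarrow> nat \<Rightarrow> complex \<Rightarrow> (nat \<Rightarrow> complex fls) \<Rightarrow> bool" for s K M where
  zero: "pfrac s K M 0 (\<lambda>_. 0)"
| step: "pfrac s K M z F \<Longrightarrow> k \<le> K \<Longrightarrow> 1 \<le> i \<Longrightarrow> i \<le> M \<Longrightarrow>
    pfrac s K M (z + c / (s + of_nat k) ^ i)
      (\<lambda>l. F l + fls_const c / fls_lin (of_nat k - of_nat l) ^ i)"

lemma pfrac_basis:
  "k \<le> K \<Longrightarrow> 1 \<le> i \<Longrightarrow> i \<le> M \<Longrightarrow>
    pfrac s K M (c / (s + of_nat k) ^ i) (\<lambda>l. fls_const c / fls_lin (of_nat k - of_nat l) ^ i)"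
  using pfrac.step[OF pfrac.zero, of k K i M s c] by simp

lemma pfrac_add:
  assumes "pfrac s K M z F" "pfrac s K M w G"
  shows "pfrac s K M (z + w) (\<lambda>l. F l + G l)"
  using assms(2)
proof (induction rule: pfrac.induct)
  case (step w G k i c)
  from pfrac.step[OF step.IH step.hyps(2-4), of c] show ?case by (simp add: add.assoc)
qed (use assms(1) in simp)

lemma pfrac_scale:
  assumes "pfrac s K M z F"
  shows "pfrac s K M (d * z) (\<lambda>l. fls_const d * F l)"
  using assms
proof (induction rule: pfrac.induct)
  case (step z F k i c)
  from pfrac.step[OF step.IH step.hyps(2-4), of "d * c"] show ?case
    by (simp add: distrib_left fls_const_mult_const[symmetric] del: fls_const_mult_const)
qed (simp add: pfrac.zero)

lemma pfrac_sum:
  assumes "\<And>i. i \<in> I \<Longrightarrow> pfrac s K M (z i) (F i)"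
  shows "pfrac s K M (\<Sum>i\<in>I. z i) (\<lambda>l. \<Sum>i\<in>I. F i l)"
  using assms
proof (induction I rule: infinite_finite_induct)
  case (insert i I)
  have "pfrac s K M (z i + (\<Sum>i\<in>I. z i)) (\<lambda>l. F i l + (\<Sum>i\<in>I. F i l))"
    using insert by (intro pfrac_add) auto
  then show ?case using insert by simp
qed (simp_all add: pfrac.zero)

text \<open>From 1/(uw) = (1/u - 1/w)/d. It is stated for an arbitrary field so that it applies both
  to complex numbers and to Laurent series.\<close>

lemma partial_fraction_step:
  fixes u w d :: "'a :: field"
  assumes "u \<noteq> 0" "w \<noteq> 0" "d \<noteq> 0" "w = u + d"
  shows "1 / (u ^ Suc i * w ^ Suc j) = 1 / d * (1 / (u ^ Suc i * w ^ j)) + (- 1 / d) * (1 / (u ^ i * w ^ Suc j))"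
proof -
  have "1 / (u ^ i * w ^ j) * (1 / (u * w)) = 1 / (u ^ i * w ^ j) * (1 / d * (1 / u - 1 / w))"
    using assms by (simp add: field_simps)
  then show ?thesis using assms(1,2) by (simp add: algebra_simps)
qed

text \<open>Induction on the total order i + j: \<open>partial_fraction_step\<close> trades the
  product for two products in which one of the exponents has dropped by one, until a single pole is
  left.\<close>

lemma pfrac_pair:
  assumes s: "\<And>k. s + of_nat k \<noteq> 0" and km: "k \<le> K" "m \<le> K" "k \<noteq> m"
  shows "i + j \<ge> 1 \<Longrightarrow> i + j \<le> M \<Longrightarrow> pfrac s K M (1 / ((s + of_nat k) ^ i * (s + of_nat m) ^ j))
    (\<lambda>l. 1 / (fls_lin (of_nat k - of_nat l) ^ i * fls_lin (of_nat m - of_nat l) ^ j))"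
proof (induction "i + j" arbitrary: i j)
  case 0
  then show ?case by simp
next
  case (Suc n)
  show ?case
  proof (cases i)
    case 0
    with Suc.prems pfrac_basis[OF km(2), of j M s 1] show ?thesis by simp
  next
    case i: (Suc i')
    show ?thesis
    proof (cases j)
      case 0
      with Suc.prems pfrac_basis[OF km(1), of i M s 1] show ?thesis by simp
    next
      case j: (Suc j')
      define d :: complex where "d = of_nat m - of_nat k"
      have d: "d \<noteq> 0" using km(3) by (simp add: d_def)
      have 1: "1 / ((s + of_nat k) ^ i * (s + of_nat m) ^ j)
          = 1 / d * (1 / ((s + of_nat k) ^ i * (s + of_nat m) ^ j'))
          + (- 1 / d) * (1 / ((s + of_nat k) ^ i' * (s + of_nat m) ^ j))"
        unfolding i j by (rule partial_fraction_step) (use s d in \<open>auto simp: d_def\<close>)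
      have 2: "1 / (fls_lin (of_nat k - of_nat l) ^ i * fls_lin (of_nat m - of_nat l) ^ j)
          = fls_const (1 / d) * (1 / (fls_lin (of_nat k - of_nat l) ^ i * fls_lin (of_nat m - of_nat l) ^ j'))
          + fls_const (- 1 / d) * (1 / (fls_lin (of_nat k - of_nat l) ^ i' * fls_lin (of_nat m - of_nat l) ^ j))" for l
      proof -
        have "fls_lin (of_nat m - of_nat l) = fls_lin (of_nat k - of_nat l) + fls_const d"
          by (simp add: fls_lin_def d_def add.assoc fls_plus_const)
        from partial_fraction_step[OF fls_lin_nonzero fls_lin_nonzero _ this, of i' j'] d
        show ?thesis unfolding i j by (simp add: fls_const_divide_const[symmetric] del: fls_const_divide_const)
      qed
      have "pfrac s K M (1 / ((s + of_nat k) ^ i * (s + of_nat m) ^ j'))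
          (\<lambda>l. 1 / (fls_lin (of_nat k - of_nat l) ^ i * fls_lin (of_nat m - of_nat l) ^ j'))"
        using Suc.hyps(2) Suc.prems i j by (intro Suc.hyps(1)) auto
      moreover have "pfrac s K M (1 / ((s + of_nat k) ^ i' * (s + of_nat m) ^ j))
          (\<lambda>l. 1 / (fls_lin (of_nat k - of_nat l) ^ i' * fls_lin (of_nat m - of_nat l) ^ j))"
        using Suc.hyps(2) Suc.prems i j by (intro Suc.hyps(1)) auto
      ultimately show ?thesis unfolding 1 2 by (intro pfrac_add pfrac_scale)
    qed
  qed
qed

text \<open>By bilinearity only products of two basic fractions matter. At a common pole the
  exponents add; distinct poles are separated by \<open>pfrac_pair\<close>.\<close>

lemma pfrac_mult:
  assumes s: "\<And>k. s + of_nat k \<noteq> 0" and "pfrac s K M z F" "pfrac s K N w G"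
  shows "pfrac s K (M + N) (z * w) (\<lambda>l. F l * G l)"
  using assms(2)
proof (induction rule: pfrac.induct)
  case (step z F k i c)
  have "pfrac s K (M + N) (1 / (s + of_nat k) ^ i * w) (\<lambda>l. 1 / fls_lin (of_nat k - of_nat l) ^ i * G l)"
    using assms(3)
  proof (induction rule: pfrac.induct)
    case (step w G m j e)
    have "pfrac s K (M + N) (1 / ((s + of_nat k) ^ i * (s + of_nat m) ^ j))
      (\<lambda>l. 1 / (fls_lin (of_nat k - of_nat l) ^ i * fls_lin (of_nat m - of_nat l) ^ j))"
    proof (cases "k = m")
      case True
      then show ?thesis
        using pfrac_basis[of k K "i + j" "M + N" s 1] step.hyps \<open>k \<le> K\<close> \<open>1 \<le> i\<close> \<open>i \<le> M\<close>
        by (simp add: power_add)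
    next
      case False
      then show ?thesis using step.hyps \<open>k \<le> K\<close> \<open>1 \<le> i\<close> \<open>i \<le> M\<close> by (intro pfrac_pair s) auto
    qed
    from pfrac_add[OF step.IH pfrac_scale[OF this, of e]] show ?case by (simp add: distrib_left)
  qed (simp add: pfrac.zero)
  from pfrac_add[OF step.IH pfrac_scale[OF this, of c]] show ?case by (simp add: distrib_right mult.assoc)
qed (simp add: pfrac.zero)

lemma pfrac_prod:
  fixes r :: nat
  assumes s: "\<And>k. s + of_nat k \<noteq> 0" and "pfrac s K q w G"
    and "\<And>j. j \<in> {1..r} \<Longrightarrow> pfrac s K (p j) (z j) (F j)"
  shows "pfrac s K ((\<Sum>j=1..r. p j) + q) ((\<Prod>j=1..r. z j) * w) (\<lambda>l. (\<Prod>j=1..r. F j l) * G l)"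
  using assms(3)
proof (induction r)
  case 0
  show ?case using assms(2) by simp
next
  case (Suc r)
  have "pfrac s K (p (Suc r) + ((\<Sum>j=1..r. p j) + q)) (z (Suc r) * ((\<Prod>j=1..r. z j) * w))
     (\<lambda>l. F (Suc r) l * ((\<Prod>j=1..r. F j l) * G l))"
    by (rule pfrac_mult[OF s Suc.prems Suc.IH]) (use Suc.prems in auto)
  then show ?case by (simp add: ac_simps)
qed

text \<open>\<open>inv_lin_pow p c\<close> is the expansion of \<open>1 / (X + c) ^ p\<close>.\<close>

definition binom_coeff :: "nat \<Rightarrow> nat \<Rightarrow> complex" where
  "binom_coeff p i = (- 1) ^ i * of_nat ((p + i - 1) choose i)"

definition inv_lin_pow :: "nat \<Rightarrow> complex \<Rightarrow> complex fps" where
  "inv_lin_pow p c = Abs_fps (\<lambda>i. binom_coeff p i / c ^ (p + i))"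

lemma inv_lin_pow_nth: "fps_nth (inv_lin_pow p c) i = binom_coeff p i / c ^ (p + i)"
  by (simp add: inv_lin_pow_def)

text \<open>Pascal's rule for negative upper entries.\<close>

lemma binom_coeff_Suc: "binom_coeff (Suc p) i + binom_coeff (Suc p) (Suc i) = binom_coeff p (Suc i)"
  by (simp add: binom_coeff_def algebra_simps)

lemma inv_lin_pow_0: "inv_lin_pow 0 c = 1"
proof (rule fps_ext)
  fix i show "fps_nth (inv_lin_pow 0 c) i = fps_nth 1 i"
    by (cases i) (simp_all add: inv_lin_pow_nth binom_coeff_def)
qed

lemma inv_lin_pow_Suc:
  assumes "c \<noteq> 0"
  shows "inv_lin_pow (Suc p) c * (fps_X + fps_const c) = inv_lin_pow p c"
proof (rule fps_ext)
  fix i show "fps_nth (inv_lin_pow (Suc p) c * (fps_X + fps_const c)) i = fps_nth (inv_lin_pow p c) i"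
  proof (cases i)
    case 0
    then show ?thesis using assms by (simp add: inv_lin_pow_nth distrib_left binom_coeff_def)
  next
    case (Suc n)
    have "fps_nth (inv_lin_pow (Suc p) c * (fps_X + fps_const c)) i
        = (binom_coeff (Suc p) n + binom_coeff (Suc p) (Suc n)) / c ^ (p + Suc n)"
      using assms by (simp add: Suc inv_lin_pow_nth distrib_left add_divide_distrib)
    then show ?thesis by (simp add: binom_coeff_Suc Suc inv_lin_pow_nth)
  qed
qed

lemma inverse_fls_lin_power:
  assumes "c \<noteq> 0"
  shows "1 / fls_lin c ^ p = fps_to_fls (inv_lin_pow p c)"
proof -
  have "fps_to_fls (fps_X + fps_const c) = fls_lin c"
    by (simp add: fls_lin_def fps_const_to_fls)
  then have "fps_to_fls (inv_lin_pow p c) * fls_lin c ^ p = 1"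
  proof (induction p)
    case (Suc p)
    have "fps_to_fls (inv_lin_pow (Suc p) c) * fls_lin c = fps_to_fls (inv_lin_pow p c)"
      using inv_lin_pow_Suc[OF assms, of p] Suc.prems by (metis fls_times_fps_to_fls)
    then show ?case using Suc by (simp add: mult.assoc[symmetric])
  qed (simp add: inv_lin_pow_0)
  then show ?thesis using fls_lin_nonzero[of c] by (simp add: field_simps)
qed

lemma fls_lin_0_power: "1 / fls_lin 0 ^ p = fls_X_inv ^ p"
  by (simp add: fls_lin_def fls_inverse_X[symmetric] power_inverse divide_inverse)

text \<open>Partial fractions without polynomial part are recovered from their principal parts: the
  coefficient of 1/(s+k)^i is the coefficient of X^(-i) in the expansion at -k.\<close>

lemma pfrac_value:
  assumes "pfrac s K M z F"
  shows "z = (\<Sum>k=0..K. \<Sum>i=1..M. fls_nth (F k) (- int i) / (s + of_nat k) ^ i)"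
  using assms
proof (induction rule: pfrac.induct)
  case (step z F k i c)
  \<comment> \<open>A basic fraction has a principal part at its own pole only, and there it is a
    single power of 1/X; at every other point it expands as a power series.\<close>
  have c: "fls_nth (fls_const c / fls_lin (of_nat k - of_nat l) ^ i) (- int i')
      = (if l = k \<and> i' = i then c else 0)" if "i' \<ge> 1" for l i'
  proof (cases "l = k")
    case True
    have "fls_const c / fls_lin 0 ^ i = fls_const c * fls_X_inv ^ i"
      using fls_lin_0_power[of i] by (metis mult.right_neutral times_divide_eq_right)
    then show ?thesis using True by (simp add: fls_X_inv_power_times_conv_shift)
  next
    case False
    then have "1 / fls_lin (of_nat k - of_nat l) ^ i = fps_to_fls (inv_lin_pow i (of_nat k - of_nat l))"
      by (intro inverse_fls_lin_power) auto
    then have "fls_const c / fls_lin (of_nat k - of_nat l) ^ i = fls_const c * fps_to_fls (inv_lin_pow i (of_nat k - of_nat l))"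
      by (metis mult.right_neutral times_divide_eq_right)
    then show ?thesis using False that by simp
  qed
  have "(\<Sum>l=0..K. \<Sum>i'=1..M. (if l = k \<and> i' = i then c else 0) / (s + of_nat l) ^ i')
      = (\<Sum>l=0..K. if l = k then c / (s + of_nat k) ^ i else 0)"
  proof (rule sum.cong)
    fix l assume "l \<in> {0..K}"
    have "(\<Sum>i'=1..M. (if l = k \<and> i' = i then c else 0) / (s + of_nat l) ^ i')
      = (\<Sum>i'=1..M. if i' = i then (if l = k then c else 0) / (s + of_nat l) ^ i else 0)"
      by (rule sum.cong) auto
    also have "\<dots> = (if l = k then c / (s + of_nat k) ^ i else 0)"
      using step.hyps by (subst sum.delta) auto
    finally show "(\<Sum>i'=1..M. (if l = k \<and> i' = i then c else 0) / (s + of_nat l) ^ i')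
      = (if l = k then c / (s + of_nat k) ^ i else 0)" .
  qed simp
  also have "\<dots> = c / (s + of_nat k) ^ i" using step.hyps by (subst sum.delta) auto
  finally show ?case
    using step.IH by (simp add: c add_divide_distrib sum.distrib)
qed simp

section \<open>Laurent expansions of the truncated functions \<open>\<phi>\<^sub>j\<close>\<close>

definition hurwitz_trunc :: "nat \<Rightarrow> nat \<Rightarrow> complex \<Rightarrow> complex \<Rightarrow> complex" where
  "hurwitz_trunc K p y s = (\<Sum>k=0..K. y ^ k / (s + of_nat k) ^ p)"

text \<open>The same rational function evaluated at X - l, that is, expanded at its pole -l.\<close>

definition hurwitz_trunc_fls :: "nat \<Rightarrow> nat \<Rightarrow> complex \<Rightarrow> nat \<Rightarrow> complex fls" where
  "hurwitz_trunc_fls K p y l = (\<Sum>k=0..K. fls_const (y ^ k) / fls_lin (of_nat k - of_nat l) ^ p)"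

lemma pfrac_hurwitz_trunc:
  "p \<ge> 1 \<Longrightarrow> pfrac s K p (hurwitz_trunc K p y s) (hurwitz_trunc_fls K p y)"
  unfolding hurwitz_trunc_def hurwitz_trunc_fls_def[abs_def] by (intro pfrac_sum pfrac_basis) auto

text \<open>Split at l. The terms k = l + j give powers of y; the terms k = l - j give powers of 1/y
  and, from the negative denominators, the sign (-1)^m.\<close>

lemma two_sided_sum:
  fixes y :: complex
  assumes "y \<noteq> 0" "l \<le> K"
  shows "(\<Sum>k\<in>{0..K} - {l}. y ^ k / (of_nat k - of_nat l) ^ m)
    = y ^ l * (zeta_partial (K - l) m y 0 + (- 1) ^ m * zeta_partial l m (inverse y) 0)"
proof -
  have split: "{0..K} - {l} = {0..<l} \<union> {l<..K}" using assms(2) by auto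
  have "(\<Sum>k\<in>{0..K} - {l}. y ^ k / (of_nat k - of_nat l) ^ m)
      = (\<Sum>k=0..<l. y ^ k / (of_nat k - of_nat l) ^ m) + (\<Sum>k\<in>{l<..K}. y ^ k / (of_nat k - of_nat l) ^ m)"
    unfolding split by (rule sum.union_disjoint) auto
  also have "(\<Sum>k\<in>{l<..K}. y ^ k / (of_nat k - of_nat l) ^ m) = (\<Sum>j=1..K-l. y ^ l * (y ^ j / of_nat j ^ m))"
    by (rule sum.reindex_bij_witness[of _ "\<lambda>j. j + l" "\<lambda>k. k - l"])
      (auto simp: of_nat_diff power_add[symmetric])
  also have "(\<Sum>k=0..<l. y ^ k / (of_nat k - of_nat l) ^ m)
      = (\<Sum>j=1..l. y ^ l * ((- 1) ^ m * (inverse y ^ j / of_nat j ^ m)))"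
  proof (rule sum.reindex_bij_witness[of _ "\<lambda>j. l - j" "\<lambda>k. l - k"])
    fix k assume k: "k \<in> {0..<l}"
    have 1: "y ^ l * inverse y ^ (l - k) = y ^ k"
    proof -
      have "y ^ l = y ^ k * y ^ (l - k)" using k by (simp add: power_add[symmetric])
      then show ?thesis using assms(1) by (simp add: power_inverse)
    qed
    have "(of_nat k - of_nat l :: complex) = - of_nat (l - k)"
      using k by (simp add: of_nat_diff)
    then have 2: "(of_nat k - of_nat l :: complex) ^ m = (- 1) ^ m * of_nat (l - k) ^ m"
      by (simp only: power_minus[of "of_nat (l - k)"])
    show "y ^ l * ((- 1) ^ m * (inverse y ^ (l - k) / of_nat (l - k) ^ m)) = y ^ k / (of_nat k - of_nat l) ^ m"
      unfolding 2 1[symmetric] by (cases "even m") simp_all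
  qed auto
  finally show ?thesis by (simp add: zeta_partial_def sum_distrib_left algebra_simps)
qed

text \<open>The contribution of all terms k \<noteq> l to the expansion at -l, divided by y^l; its
  coefficients come from \<open>two_sided_sum\<close>.\<close>

definition regular_part :: "nat \<Rightarrow> nat \<Rightarrow> complex \<Rightarrow> nat \<Rightarrow> complex fps" where
  "regular_part K p y l = Abs_fps (\<lambda>i. binom_coeff p i *
     (zeta_partial (K - l) (p + i) y 0 + (- 1) ^ (p + i) * zeta_partial l (p + i) (inverse y) 0))"

lemma fps_to_fls_sum: "fps_to_fls (\<Sum>i\<in>I. f i) = (\<Sum>i\<in>I. fps_to_fls (f i))"
  by (induction I rule: infinite_finite_induct) auto

text \<open>The term k = l is the whole pole y^l X^(-p), the other terms are regular there, and the
  pole is factored out.\<close>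

lemma hurwitz_trunc_fls_eq:
  assumes "y \<noteq> 0" "l \<le> K"
  shows "hurwitz_trunc_fls K p y l
    = fls_const (y ^ l) * fls_X_inv ^ p * fps_to_fls (1 + fps_X ^ p * regular_part K p y l)"
proof -
  have "hurwitz_trunc_fls K p y l = fls_const (y ^ l) / fls_lin 0 ^ p
      + (\<Sum>k\<in>{0..K} - {l}. fls_const (y ^ k) / fls_lin (of_nat k - of_nat l) ^ p)"
    unfolding hurwitz_trunc_fls_def using assms(2) by (subst sum.remove[of _ l]) auto
  also have "fls_const (y ^ l) / fls_lin 0 ^ p = fls_const (y ^ l) * fls_X_inv ^ p"
    using fls_lin_0_power[of p] by (metis mult.right_neutral times_divide_eq_right)
  also have "(\<Sum>k\<in>{0..K} - {l}. fls_const (y ^ k) / fls_lin (of_nat k - of_nat l) ^ p)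
      = (\<Sum>k\<in>{0..K} - {l}. fps_to_fls (fps_const (y ^ k) * inv_lin_pow p (of_nat k - of_nat l)))"
  proof (rule sum.cong)
    fix k assume "k \<in> {0..K} - {l}"
    then have "1 / fls_lin (of_nat k - of_nat l) ^ p = fps_to_fls (inv_lin_pow p (of_nat k - of_nat l))"
      by (intro inverse_fls_lin_power) auto
    then show "fls_const (y ^ k) / fls_lin (of_nat k - of_nat l) ^ p
        = fps_to_fls (fps_const (y ^ k) * inv_lin_pow p (of_nat k - of_nat l))"
      by (metis mult.right_neutral times_divide_eq_right fls_times_fps_to_fls fps_const_to_fls)
  qed simp
  also have "\<dots> = fps_to_fls (fps_const (y ^ l) * regular_part K p y l)"
  proof -
    have "(\<Sum>k\<in>{0..K} - {l}. fps_const (y ^ k) * inv_lin_pow p (of_nat k - of_nat l))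
        = fps_const (y ^ l) * regular_part K p y l"
    proof (rule fps_ext)
      fix i
      have "fps_nth (\<Sum>k\<in>{0..K} - {l}. fps_const (y ^ k) * inv_lin_pow p (of_nat k - of_nat l)) i
         = binom_coeff p i * (\<Sum>k\<in>{0..K} - {l}. y ^ k / (of_nat k - of_nat l) ^ (p + i))"
        by (simp add: fps_sum_nth inv_lin_pow_nth sum_distrib_left ac_simps)
      also have "\<dots> = fps_nth (fps_const (y ^ l) * regular_part K p y l) i"
        by (simp add: two_sided_sum[OF assms] regular_part_def ac_simps)
      finally show "fps_nth (\<Sum>k\<in>{0..K} - {l}. fps_const (y ^ k) * inv_lin_pow p (of_nat k - of_nat l)) i
        = fps_nth (fps_const (y ^ l) * regular_part K p y l) i" .
    qed
    then show ?thesis by (simp add: fps_to_fls_sum[symmetric])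
  qed
  also have "\<dots> = fls_const (y ^ l) * fls_X_inv ^ p * (fls_X ^ p * fps_to_fls (regular_part K p y l))"
  proof -
    have "fls_X_inv ^ p * fls_X ^ p = (1 :: complex fls)"
      by (simp add: power_mult_distrib[symmetric] fls_inverse_X[symmetric])
    then show ?thesis by (simp add: fls_times_fps_to_fls mult.assoc)
  qed
  finally show ?thesis
    by (simp add: fls_times_fps_to_fls fps_to_fls_power distrib_left mult.assoc)
qed

text \<open>The product of the expansions at -l after all poles have been factored out. In each
  factor the 1 stands for the pole and the other summand for the regular part.\<close>

definition polar_series :: "nat \<Rightarrow> nat \<Rightarrow> (nat \<Rightarrow> nat) \<Rightarrow> (nat \<Rightarrow> complex) \<Rightarrow> nat \<Rightarrow> complex fps" where
  "polar_series K r p y l = (\<Prod>j=1..r. 1 + fps_X ^ p j * regular_part K (p j) (y j) l)"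

lemma prod_hurwitz_trunc_fls:
  assumes "\<And>j. j \<in> {1..r} \<Longrightarrow> y j \<noteq> 0" "l \<le> K"
  shows "(\<Prod>j=1..r. hurwitz_trunc_fls K (p j) (y j) l)
    = fls_const ((\<Prod>j=1..r. y j) ^ l) * fls_X_inv ^ (\<Sum>j=1..r. p j) * fps_to_fls (polar_series K r p y l)"
  using assms(1)
proof (induction r)
  case (Suc r)
  have "(\<Prod>j=1..r. hurwitz_trunc_fls K (p j) (y j) l)
    = fls_const ((\<Prod>j=1..r. y j) ^ l) * fls_X_inv ^ (\<Sum>j=1..r. p j) * fps_to_fls (polar_series K r p y l)"
    using Suc by simp
  moreover have "fls_const ((\<Prod>j=1..Suc r. y j) ^ l) = fls_const ((\<Prod>j=1..r. y j) ^ l) * fls_const (y (Suc r) ^ l)"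
    by (simp add: power_mult_distrib)
  moreover have "hurwitz_trunc_fls K (p (Suc r)) (y (Suc r)) l = fls_const (y (Suc r) ^ l) * fls_X_inv ^ p (Suc r)
      * fps_to_fls (1 + fps_X ^ p (Suc r) * regular_part K (p (Suc r)) (y (Suc r)) l)"
    using Suc.prems assms(2) by (intro hurwitz_trunc_fls_eq) auto
  moreover have "fps_to_fls (polar_series K (Suc r) p y l) = fps_to_fls (polar_series K r p y l)
      * fps_to_fls (1 + fps_X ^ p (Suc r) * regular_part K (p (Suc r)) (y (Suc r)) l)"
    by (simp add: polar_series_def fls_times_fps_to_fls)
  ultimately show ?case by (simp only: prod.nat_ivl_Suc' sum.nat_ivl_Suc' power_add le_add1 Suc_eq_plus1[symmetric]) 
     (simp add: ac_simps power_add)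
qed (simp add: polar_series_def)

text \<open>The principal parts are read off with \<open>pfrac_value\<close>. At 0 the factor 1/s^q
  adds q to the pole order P of the product; at -k with k \<ge> 1 it is the power series
  \<open>inv_lin_pow q (- of_nat k)\<close>, so the order is at most P.\<close>

lemma hurwitz_product_expansion:
  assumes s: "\<And>k. s + of_nat k \<noteq> 0" and p: "\<And>j. j \<in> {1..r} \<Longrightarrow> p j \<ge> 1" and q: "q \<ge> 1"
    and y: "\<And>j. j \<in> {1..r} \<Longrightarrow> y j \<noteq> 0"
  defines "P \<equiv> (\<Sum>j=1..r. p j)" and "Y \<equiv> (\<Prod>j=1..r. y j)"
  shows "(\<Prod>j=1..r. hurwitz_trunc K (p j) (y j) s) / s ^ q
    = (\<Sum>i=1..P+q. fps_nth (polar_series K r p y 0) (P + q - i) / s ^ i)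
    + (\<Sum>k=1..K. \<Sum>i=1..P. Y ^ k * fps_nth (inv_lin_pow q (- of_nat k) * polar_series K r p y k) (P - i)
         / (s + of_nat k) ^ i)"
proof -
  define F where "F l = (\<Prod>j=1..r. hurwitz_trunc_fls K (p j) (y j) l) * (1 / fls_lin (of_nat 0 - of_nat l) ^ q)" for l
  have "pfrac s K q (1 / (s + of_nat 0) ^ q) (\<lambda>l. fls_const 1 / fls_lin (of_nat 0 - of_nat l) ^ q)"
    using q by (intro pfrac_basis) auto
  then have "pfrac s K q (1 / s ^ q) (\<lambda>l. 1 / fls_lin (of_nat 0 - of_nat l) ^ q)" by simp
  then have "pfrac s K (P + q) ((\<Prod>j=1..r. hurwitz_trunc K (p j) (y j) s) * (1 / s ^ q)) F"
    unfolding F_def[abs_def] P_def by (rule pfrac_prod[OF s]) (intro pfrac_hurwitz_trunc p)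
  from pfrac_value[OF this]
  have 1: "(\<Prod>j=1..r. hurwitz_trunc K (p j) (y j) s) / s ^ q
      = (\<Sum>k=0..K. \<Sum>i=1..P+q. fls_nth (F k) (- int i) / (s + of_nat k) ^ i)" by simp
  have F0: "fls_nth (F 0) (- int i) = fps_nth (polar_series K r p y 0) (P + q - i)" if "i \<le> P + q" for i
  proof -
    have "F 0 = fls_X_inv ^ (P + q) * fps_to_fls (polar_series K r p y 0)"
      using fls_lin_0_power[of q] prod_hurwitz_trunc_fls[of r y 0 K p] y
      by (simp add: F_def P_def power_add ac_simps)
    moreover have "nat (int (P + q) - int i) = P + q - i" "int (P + q) - int i \<ge> 0" using that by auto
    ultimately show ?thesis by (simp add: fls_X_inv_power_times_conv_shift)
  qed
  have Fk: "fls_nth (F k) (- int i) = (if i \<le> P then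
      Y ^ k * fps_nth (inv_lin_pow q (- of_nat k) * polar_series K r p y k) (P - i) else 0)"
    if "k \<in> {1..K}" for i k
  proof -
    have "F k = fls_const (Y ^ k) * (fls_X_inv ^ P * fps_to_fls (inv_lin_pow q (- of_nat k) * polar_series K r p y k))"
      using inverse_fls_lin_power[of "- of_nat k" q] prod_hurwitz_trunc_fls[of r y k K p] y that
      by (simp add: F_def P_def Y_def fls_times_fps_to_fls ac_simps)
    moreover have "int P - int i < 0" if "\<not> i \<le> P" using that by simp
    moreover have "nat (int P - int i) = P - i" "int P - int i \<ge> 0" if "i \<le> P" using that by auto
    ultimately show ?thesis by (auto simp: fls_X_inv_power_times_conv_shift)
  qed
  have "(\<Sum>k=0..K. \<Sum>i=1..P+q. fls_nth (F k) (- int i) / (s + of_nat k) ^ i)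
      = (\<Sum>i=1..P+q. fls_nth (F 0) (- int i) / s ^ i)
      + (\<Sum>k=1..K. \<Sum>i=1..P+q. fls_nth (F k) (- int i) / (s + of_nat k) ^ i)"
    by (subst sum.atLeast_Suc_atMost) auto
  also have "(\<Sum>i=1..P+q. fls_nth (F 0) (- int i) / s ^ i)
      = (\<Sum>i=1..P+q. fps_nth (polar_series K r p y 0) (P + q - i) / s ^ i)"
    by (intro sum.cong) (auto simp: F0)
  also have "(\<Sum>k=1..K. \<Sum>i=1..P+q. fls_nth (F k) (- int i) / (s + of_nat k) ^ i)
      = (\<Sum>k=1..K. \<Sum>i=1..P. Y ^ k * fps_nth (inv_lin_pow q (- of_nat k) * polar_series K r p y k) (P - i)
         / (s + of_nat k) ^ i)"
  proof (rule sum.cong)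
    fix k assume k: "k \<in> {1..K}"
    show "(\<Sum>i=1..P+q. fls_nth (F k) (- int i) / (s + of_nat k) ^ i)
      = (\<Sum>i=1..P. Y ^ k * fps_nth (inv_lin_pow q (- of_nat k) * polar_series K r p y k) (P - i)
         / (s + of_nat k) ^ i)"
      by (rule sum.mono_neutral_cong_right) (auto simp: Fk[OF k])
  qed simp
  finally show ?thesis unfolding 1 .
qed

section \<open>Values and sums along the bilateral progression\<close>

text \<open>Here s = a + n with n = m - 1 \<ge> 0. Since s + k = (k + m) + (a - 1), the indices run
  from m to K + m; subtracting the partial sum up to m removes the term m too, so it is added
  back.\<close>

lemma hurwitz_trunc_right:
  assumes "y \<noteq> 0" "m \<ge> 1"
  shows "hurwitz_trunc K p y (a + of_nat m - 1)
    = inverse y ^ m * (zeta_partial (K + m) p y (a - 1) - zeta_partial m p y (a - 1)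
        + y ^ m / (of_nat m + (a - 1)) ^ p)"
proof (induction K)
  case 0
  then show ?case using assms by (simp add: hurwitz_trunc_def power_inverse algebra_simps)
next
  case (Suc K)
  have "hurwitz_trunc (Suc K) p y (a + of_nat m - 1) = hurwitz_trunc K p y (a + of_nat m - 1)
      + y ^ Suc K / (a + of_nat m - 1 + of_nat (Suc K)) ^ p"
    by (simp add: hurwitz_trunc_def)
  also have "y ^ Suc K / (a + of_nat m - 1 + of_nat (Suc K)) ^ p
      = inverse y ^ m * (y ^ (Suc K + m) / (of_nat (Suc K + m) + (a - 1)) ^ p)"
  proof -
    have 1: "inverse y ^ m * y ^ (Suc K + m) = y ^ Suc K"
      using assms by (simp add: power_add power_inverse field_simps)
    have 2: "a + of_nat m - 1 + of_nat (Suc K) = of_nat (Suc K + m) + (a - 1)" by simp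
    show ?thesis by (simp only: times_divide_eq_right 1 2)
  qed
  finally show ?case
    unfolding Suc.IH add_Suc zeta_partial_Suc by (simp only: algebra_simps)
qed

lemma reflect_power: "(a - of_nat m :: complex) ^ p = (- 1) ^ p * (of_nat m + - a) ^ p"
  by (simp add: power_mult_distrib[symmetric])

text \<open>Here s = a + n with n = -m. For k < m the denominator is the negative of (m - k) - a,
  giving parameter -a and a sign; for k \<ge> m it is (k - m + 1) + (a - 1), giving parameter a -
  1.\<close>

lemma hurwitz_trunc_left:
  assumes "y \<noteq> 0" "m \<le> K"
  shows "hurwitz_trunc K p y (a - of_nat m)
    = y ^ m * (inverse y * zeta_partial (Suc K - m) p y (a - 1) + (- 1) ^ p * zeta_partial m p (inverse y) (- a))"
proof -
  have "{0..K} = {0..<m} \<union> {m..K}" using assms(2) by auto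
  then have "hurwitz_trunc K p y (a - of_nat m) = (\<Sum>k=0..<m. y ^ k / (a - of_nat m + of_nat k) ^ p)
      + (\<Sum>k=m..K. y ^ k / (a - of_nat m + of_nat k) ^ p)"
    by (simp add: hurwitz_trunc_def sum.union_disjoint ivl_disj_int)
  also have "(\<Sum>k=0..<m. y ^ k / (a - of_nat m + of_nat k) ^ p)
      = (\<Sum>j=1..m. y ^ m * ((- 1) ^ p * (inverse y ^ j / (of_nat j + - a) ^ p)))"
  proof (rule sum.reindex_bij_witness[of _ "\<lambda>j. m - j" "\<lambda>k. m - k"])
    fix k assume k: "k \<in> {0..<m}"
    have 1: "y ^ m * inverse y ^ (m - k) = y ^ k"
      using k assms(1) by (simp add: power_inverse power_diff field_simps)
    have "a - of_nat m + of_nat k = a - of_nat (m - k)" using k by (simp add: of_nat_diff)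
    then have 2: "(a - of_nat m + of_nat k) ^ p = (- 1) ^ p * (of_nat (m - k) + - a) ^ p"
      by (simp only: reflect_power)
    show "y ^ m * ((- 1) ^ p * (inverse y ^ (m - k) / (of_nat (m - k) + - a) ^ p)) = y ^ k / (a - of_nat m + of_nat k) ^ p"
      unfolding 2 1[symmetric] by (cases "even p") simp_all
  qed auto
  also have "(\<Sum>k=m..K. y ^ k / (a - of_nat m + of_nat k) ^ p)
      = (\<Sum>j=1..Suc K - m. y ^ m * (inverse y * (y ^ j / (of_nat j + (a - 1)) ^ p)))"
  proof (rule sum.reindex_bij_witness[of _ "\<lambda>j. j + m - 1" "\<lambda>k. Suc k - m"])
    fix k assume k: "k \<in> {m..K}"
    have 1: "y ^ m * (inverse y * y ^ (Suc k - m)) = y ^ k"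
    proof -
      have "y ^ k = y ^ m * y ^ (k - m)" using k by (simp add: power_add[symmetric])
      then show ?thesis using k assms(1) by (simp add: Suc_diff_le mult.assoc[symmetric])
    qed
    have "of_nat (Suc k - m) + (a - 1) = a - of_nat m + of_nat k"
      using k by (simp add: of_nat_diff Suc_diff_le)
    then show "y ^ m * (inverse y * (y ^ (Suc k - m) / (of_nat (Suc k - m) + (a - 1)) ^ p)) = y ^ k / (a - of_nat m + of_nat k) ^ p"
      by (simp only: times_divide_eq_right 1)
  qed auto
  finally show ?thesis by (simp add: zeta_partial_def sum_distrib_left algebra_simps)
qed

text \<open>Adding k moves the window of the progression to the right. The terms m \<le> k of the
  second half cross over to parameter a - 1 and supply exactly the first k terms that the shifted
  first half lacks.\<close>

lemma shifted_bilateral_sum: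
  assumes "x \<noteq> 0" "k \<le> K"
  shows "(\<Sum>m=1..K. x * inverse x ^ m / (a + of_nat m - 1 + of_nat k) ^ i + x ^ m / (a - of_nat m + of_nat k) ^ i)
    = x ^ k * (x * zeta_partial (K + k) i (inverse x) (a - 1) + (- 1) ^ i * zeta_partial (K - k) i x (- a))"
proof -
  have 1: "(\<Sum>m=1..N. x * inverse x ^ m / (a + of_nat m - 1 + of_nat k) ^ i)
      = x ^ k * (x * (zeta_partial (N + k) i (inverse x) (a - 1) - zeta_partial k i (inverse x) (a - 1)))" for N
  proof (induction N)
    case (Suc N)
    have "x * inverse x ^ Suc N = x ^ k * (x * inverse x ^ (Suc N + k))"
      using assms(1) by (simp add: power_add power_inverse field_simps)
    moreover have "a + of_nat (Suc N) - 1 + of_nat k = of_nat (Suc N + k) + (a - 1)" by simp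
    moreover have "zeta_partial (Suc N + k) i (inverse x) (a - 1) = zeta_partial (N + k) i (inverse x) (a - 1)
      + inverse x ^ (Suc N + k) / (of_nat (Suc N + k) + (a - 1)) ^ i"
      using zeta_partial_Suc[of "N + k"] by simp
    ultimately show ?case using Suc.IH
      by (simp only: sum.cl_ivl_Suc) (simp only: algebra_simps times_divide_eq_right if_False not_less le_add1, simp)
  qed simp
  have 2: "(\<Sum>m=1..k. x ^ m / (a - of_nat m + of_nat k) ^ i) = x ^ k * (x * zeta_partial k i (inverse x) (a - 1))"
  proof -
    have "(\<Sum>m=1..k. x ^ m / (a - of_nat m + of_nat k) ^ i)
        = (\<Sum>j=1..k. x ^ k * (x * (inverse x ^ j / (of_nat j + (a - 1)) ^ i)))"
    proof (rule sum.reindex_bij_witness[of _ "\<lambda>j. Suc k - j" "\<lambda>m. Suc k - m"])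
      fix m assume m: "m \<in> {1..k}"
      have 1: "x ^ k * (x * inverse x ^ (Suc k - m)) = x ^ m"
      proof -
        have "x ^ Suc k = x ^ m * x ^ (Suc k - m)" using m by (simp add: power_add[symmetric])
        then show ?thesis using assms(1) by (simp add: power_inverse field_simps)
      qed
      have "of_nat (Suc k - m) + (a - 1) = a - of_nat m + of_nat k"
        using m by (simp add: of_nat_diff)
      then show "x ^ k * (x * (inverse x ^ (Suc k - m) / (of_nat (Suc k - m) + (a - 1)) ^ i)) = x ^ m / (a - of_nat m + of_nat k) ^ i"
        by (simp only: times_divide_eq_right 1)
    qed auto
    then show ?thesis by (simp add: zeta_partial_def sum_distrib_left)
  qed
  have 3: "(\<Sum>m=k+1..K. x ^ m / (a - of_nat m + of_nat k) ^ i) = x ^ k * ((- 1) ^ i * zeta_partial (K - k) i x (- a))"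
  proof -
    have "(\<Sum>m=k+1..K. x ^ m / (a - of_nat m + of_nat k) ^ i)
        = (\<Sum>j=1..K-k. x ^ k * ((- 1) ^ i * (x ^ j / (of_nat j + - a) ^ i)))"
    proof (rule sum.reindex_bij_witness[of _ "\<lambda>j. j + k" "\<lambda>m. m - k"])
      fix m assume m: "m \<in> {k+1..K}"
      have 1: "x ^ k * x ^ (m - k) = x ^ m" using m by (simp add: power_add[symmetric])
      have "a - of_nat m + of_nat k = a - of_nat (m - k)" using m by (simp add: of_nat_diff)
      then have 2: "(a - of_nat m + of_nat k) ^ i = (- 1) ^ i * (of_nat (m - k) + - a) ^ i"
        by (simp only: reflect_power)
      show "x ^ k * ((- 1) ^ i * (x ^ (m - k) / (of_nat (m - k) + - a) ^ i)) = x ^ m / (a - of_nat m + of_nat k) ^ i"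
        unfolding 1[symmetric] 2 by (cases "even i") simp_all
    qed auto
    then show ?thesis by (simp add: zeta_partial_def sum_distrib_left)
  qed
  have "{1..K} = {1..k} \<union> {k+1..K}" using assms(2) by auto
  then have "(\<Sum>m=1..K. x ^ m / (a - of_nat m + of_nat k) ^ i)
      = (\<Sum>m=1..k. x ^ m / (a - of_nat m + of_nat k) ^ i) + (\<Sum>m=k+1..K. x ^ m / (a - of_nat m + of_nat k) ^ i)"
    by (simp add: sum.union_disjoint)
  then show ?thesis unfolding sum.distrib 1 2 3 by (simp add: algebra_simps)
qed

subsection \<open>Passage to the limit\<close>

text \<open>For fixed l and growing K the sum of length K - l becomes a value of \<open>Li\<close>.
  The sum of length l does not depend on K and survives as an inner partial sum of a classical Euler
  sum.\<close>

definition regular_limit :: "nat \<Rightarrow> complex \<Rightarrow> nat \<Rightarrow> complex fps" where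
  "regular_limit p y l = Abs_fps (\<lambda>i. binom_coeff p i *
     (Li (p + i) y 1 + (- 1) ^ (p + i) * zeta_partial l (p + i) (inverse y) 0))"

definition polar_limit :: "nat \<Rightarrow> (nat \<Rightarrow> nat) \<Rightarrow> (nat \<Rightarrow> complex) \<Rightarrow> nat \<Rightarrow> complex fps" where
  "polar_limit r p y l = (\<Prod>j=1..r. 1 + fps_X ^ p j * regular_limit (p j) (y j) l)"

definition regular_params :: "nat \<Rightarrow> (nat \<Rightarrow> nat) \<Rightarrow> (nat \<Rightarrow> complex) \<Rightarrow> bool" where
  "regular_params r p y \<longleftrightarrow> (\<forall>j\<in>{1..r}. p j \<ge> 1 \<and> root_of_unity (y j) \<and> (p j, y j) \<noteq> (1, 1))"

lemma regular_params_Suc: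
  "regular_params (Suc r) p y \<longleftrightarrow> regular_params r p y \<and>
     p (Suc r) \<ge> 1 \<and> root_of_unity (y (Suc r)) \<and> (p (Suc r), y (Suc r)) \<noteq> (1, 1)"
proof -
  have "{1..Suc r} = insert (Suc r) {1..r}" by auto
  then show ?thesis unfolding regular_params_def by auto
qed

lemma nonpole_0: "nonpole 0"
  by (simp add: nonpole_def)

lemma binom_coeff_rat_adjoin: "binom_coeff p i \<in> rat_adjoin H"
  unfolding binom_coeff_def by (intro rat_adjoin.mult rat_adjoin_minus_one_power rat_adjoin_of_nat)

text \<open>Separates the pole of a new factor from its regular part, whose use costs p degrees; the
  degree count rests on this cost.\<close>

lemma fps_nth_mult_one_plus:
  "fps_nth (U * (1 + fps_X ^ p * R)) d
     = fps_nth U d + (if p \<le> d then \<Sum>i=0..d-p. fps_nth U i * fps_nth R (d - p - i) else 0)"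
  for U R :: "complex fps"
proof -
  have "U * (1 + fps_X ^ p * R) = U + fps_X ^ p * (U * R)" by (simp add: algebra_simps)
  then show ?thesis by (simp only: fps_add_nth fps_X_power_mult_nth fps_mult_nth[of U R]) auto
qed

lemma approx_regular_part:
  assumes "p \<ge> 1" "root_of_unity y" "(p, y) \<noteq> (1, 1)"
  shows "approx 0 (\<lambda>K l. fps_nth (regular_part K p y l) i) (\<lambda>l. fps_nth (regular_limit p y l) i)"
proof -
  have *: "p + i \<ge> 1" "(p + i, y) \<noteq> (1, 1)" "root_of_unity (inverse y)" "(p + i, inverse y) \<noteq> (1, 1)"
    using assms by (auto simp: root_of_unity_inverse)
  have "approx 0 (\<lambda>K l. zeta_partial (K - l) (p + i) y 0) (\<lambda>l. Li (p + i) y (0 + 1))"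
    by (rule approx_zeta_tail[OF assms(2) *(1,2) nonpole_0]) simp
  then have "approx 0 (\<lambda>K l. binom_coeff p i * (zeta_partial (K - l) (p + i) y 0
      + (- 1) ^ (p + i) * zeta_partial l (p + i) (inverse y) 0))
    (\<lambda>l. binom_coeff p i * (Li (p + i) y (0 + 1) + (- 1) ^ (p + i) * zeta_partial l (p + i) (inverse y) 0))"
    by (intro approx_scale approx_add approx_zeta * nonpole_0)
  then show ?thesis by (simp add: regular_part_def regular_limit_def)
qed

text \<open>The decay 1/l is supplied by \<open>inv_lin_pow\<close>, whose coefficients are O(1/l^q)
  with q \<ge> 1; each further factor has bounded coefficients and keeps the exponent 1.\<close>

lemma approx_polar:
  assumes "regular_params r p y" "root_of_unity v" "q \<ge> 1"
  shows "approx 1 (\<lambda>K l. v ^ l * fps_nth (inv_lin_pow q (- of_nat l) * polar_series K r p y l) d)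
    (\<lambda>l. v ^ l * fps_nth (inv_lin_pow q (- of_nat l) * polar_limit r p y l) d)"
  using assms(1)
proof (induction r arbitrary: d)
  case 0
  have "approx 1 (\<lambda>K l. (- 1) ^ (q + d) * binom_coeff q d * (v ^ l / (of_nat l + 0) ^ (q + d)))
      (\<lambda>l. (- 1) ^ (q + d) * binom_coeff q d * (v ^ l / (of_nat l + 0) ^ (q + d)))"
    using assms by (intro approx_scale approx_power nonpole_0 root_of_unity_norm) auto
  moreover have "v ^ l * fps_nth (inv_lin_pow q (- of_nat l)) d
      = (- 1) ^ (q + d) * binom_coeff q d * (v ^ l / (of_nat l + 0) ^ (q + d))" for l
    by (cases "even (q + d)") (simp_all add: inv_lin_pow_nth)
  ultimately show ?case by (simp add: polar_series_def polar_limit_def)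
next
  case (Suc r)
  let ?U = "\<lambda>K l. inv_lin_pow q (- of_nat l) * polar_series K r p y l"
  let ?u = "\<lambda>l. inv_lin_pow q (- of_nat l) * polar_limit r p y l"
  let ?R = "\<lambda>K l. regular_part K (p (Suc r)) (y (Suc r)) l"
  let ?R' = "\<lambda>l. regular_limit (p (Suc r)) (y (Suc r)) l"
  have IH: "approx 1 (\<lambda>K l. v ^ l * fps_nth (?U K l) d) (\<lambda>l. v ^ l * fps_nth (?u l) d)" for d
    using Suc by (simp add: regular_params_Suc)
  have R: "approx 0 (\<lambda>K l. fps_nth (?R K l) i) (\<lambda>l. fps_nth (?R' l) i)" for i
    using Suc.prems by (intro approx_regular_part) (auto simp: regular_params_Suc)
  have e: "v ^ l * fps_nth (inv_lin_pow q (- of_nat l) * (A * (1 + fps_X ^ p (Suc r) * B))) d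
      = v ^ l * fps_nth (inv_lin_pow q (- of_nat l) * A) d + (\<Sum>i\<in>{i. p (Suc r) \<le> d \<and> i \<le> d - p (Suc r)}.
          (v ^ l * fps_nth (inv_lin_pow q (- of_nat l) * A) i) * fps_nth B (d - p (Suc r) - i))" for l A B
    using fps_nth_mult_one_plus[of "inv_lin_pow q (- of_nat l) * A" "p (Suc r)" B d]
    by (auto simp: mult.assoc distrib_left sum_distrib_left atLeast0AtMost atMost_def)
  have "approx (1 + 0) (\<lambda>K l. (v ^ l * fps_nth (?U K l) i) * fps_nth (?R K l) j)
      (\<lambda>l. (v ^ l * fps_nth (?u l) i) * fps_nth (?R' l) j)" for i j
    by (rule approx_mult[OF IH R])
  then have "approx 1 (\<lambda>K l. v ^ l * fps_nth (?U K l) d + (\<Sum>i\<in>{i. p (Suc r) \<le> d \<and> i \<le> d - p (Suc r)}.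
          (v ^ l * fps_nth (?U K l) i) * fps_nth (?R K l) (d - p (Suc r) - i)))
      (\<lambda>l. v ^ l * fps_nth (?u l) d + (\<Sum>i\<in>{i. p (Suc r) \<le> d \<and> i \<le> d - p (Suc r)}.
          (v ^ l * fps_nth (?u l) i) * fps_nth (?R' l) (d - p (Suc r) - i)))"
    by (intro approx_add approx_sum IH) auto
  then show ?case by (simp only: e[symmetric]) (simp add: polar_series_def polar_limit_def)
qed

text \<open>Using the regular parts of all r factors costs the sum of all \<open>p j\<close>
  degrees. A coefficient of smaller index therefore takes the pole of at least one factor and
  contains at most r - 1 partial sums.\<close>

lemma euler_comb_polar:
  assumes "regular_params r p y" "root_of_unity v" "q \<ge> 1" "(q, v) \<noteq> (1, 1)"
    and Li: "\<And>j i. j \<in> {1..r} \<Longrightarrow> Li (p j + i) (y j) 1 \<in> comb_ring H G"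
  shows "euler_comb (comb_ring H G) 0 (if d < (\<Sum>j=1..r. p j) then r else Suc r)
    (\<lambda>l. v ^ l * fps_nth (inv_lin_pow q (- of_nat l) * polar_limit r p y l) d)"
  using assms(1) Li
proof (induction r arbitrary: d)
  case 0
  \<comment> \<open>In degree 0 the inner parameters are dummies; the monomial is v^l /
    l^(q+d).\<close>
  have "euler_comb (comb_ring H G) 0 1 (euler_monomial 0 0 (\<lambda>_. 1) (q + d) (\<lambda>_. 1) v)"
    using assms by (intro euler_comb_monomial)
      (auto simp: convergent_params_def euler_sum_params_def intro: comb_ring_scalar rat_adjoin.one)
  moreover have "(- 1) ^ (q + d) * binom_coeff q d \<in> comb_ring H G"
    by (intro comb_ring_scalar rat_adjoin.mult rat_adjoin_minus_one_power binom_coeff_rat_adjoin)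
  ultimately have "euler_comb (comb_ring H G) 0 1
      (\<lambda>l. (- 1) ^ (q + d) * binom_coeff q d * euler_monomial 0 0 (\<lambda>_. 1) (q + d) (\<lambda>_. 1) v l)"
    by (rule euler_comb_scale)
  moreover have "v ^ l * fps_nth (inv_lin_pow q (- of_nat l)) d
      = (- 1) ^ (q + d) * binom_coeff q d * euler_monomial 0 0 (\<lambda>_. 1) (q + d) (\<lambda>_. 1) v l" for l
    by (cases "even (q + d)") (simp_all add: inv_lin_pow_nth euler_monomial_def)
  ultimately show ?case by (simp add: polar_limit_def)
next
  case (Suc r)
  let ?A = "comb_ring H G"
  let ?u = "\<lambda>l. inv_lin_pow q (- of_nat l) * polar_limit r p y l"
  let ?p = "p (Suc r)" and ?y = "y (Suc r)"
  let ?R = "\<lambda>l. regular_limit ?p ?y l"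
  have IH: "euler_comb ?A 0 (if d < (\<Sum>j=1..r. p j) then r else Suc r) (\<lambda>l. v ^ l * fps_nth (?u l) d)" for d
    using Suc by (simp add: regular_params_Suc)
  have mult: "euler_comb ?A 0 (Suc e) (\<lambda>l. f l * fps_nth (?R l) i)" if "euler_comb ?A 0 e f" for e f i
  proof -
    have "binom_coeff ?p i * Li (?p + i) ?y 1 \<in> ?A"
      using Suc.prems by (intro comb_ring_mult comb_ring_scalar[OF binom_coeff_rat_adjoin]) simp
    moreover have "binom_coeff ?p i * (- 1) ^ (?p + i) \<in> ?A"
      by (intro comb_ring_scalar rat_adjoin.mult rat_adjoin_minus_one_power binom_coeff_rat_adjoin)
    moreover have "euler_comb ?A 0 (Suc e) (\<lambda>l. f l * zeta_partial l (?p + i) (inverse ?y) 0)"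
      using that Suc.prems by (intro euler_comb_zeta) (auto simp: regular_params_Suc root_of_unity_inverse)
    ultimately have "euler_comb ?A 0 (Suc e) (\<lambda>l. (binom_coeff ?p i * Li (?p + i) ?y 1) * f l
        + (binom_coeff ?p i * (- 1) ^ (?p + i)) * (f l * zeta_partial l (?p + i) (inverse ?y) 0))"
      using euler_comb_mono[OF that, of "Suc e"] by (intro euler_comb_add euler_comb_scale) auto
    then show ?thesis by (simp add: regular_limit_def algebra_simps)
  qed
  have e: "v ^ l * fps_nth (inv_lin_pow q (- of_nat l) * (A * (1 + fps_X ^ ?p * B))) d
      = v ^ l * fps_nth (inv_lin_pow q (- of_nat l) * A) d + (\<Sum>i\<in>{i. ?p \<le> d \<and> i \<le> d - ?p}.
          (v ^ l * fps_nth (inv_lin_pow q (- of_nat l) * A) i) * fps_nth B (d - ?p - i))" for l A B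
    using fps_nth_mult_one_plus[of "inv_lin_pow q (- of_nat l) * A" ?p B d]
    by (auto simp: mult.assoc distrib_left sum_distrib_left atLeast0AtMost atMost_def)
  let ?D = "if d < (\<Sum>j=1..Suc r. p j) then Suc r else Suc (Suc r)"
  \<comment> \<open>If d lies below the new total, then i \<le> d - p lies below the old one, so the
    smaller bound holds before the new factor raises it by one.\<close>
  have "euler_comb ?A 0 ?D (\<lambda>l. v ^ l * fps_nth (?u l) d)"
    using euler_comb_mono[OF IH[of d], of ?D] by auto
  moreover have "euler_comb ?A 0 ?D (\<lambda>l. (v ^ l * fps_nth (?u l) i) * fps_nth (?R l) (d - ?p - i))"
    if "?p \<le> d" "i \<le> d - ?p" for i
    by (rule euler_comb_mono[OF mult[OF IH[of i]]]) (use that in auto)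
  ultimately have "euler_comb ?A 0 ?D (\<lambda>l. v ^ l * fps_nth (?u l) d + (\<Sum>i\<in>{i. ?p \<le> d \<and> i \<le> d - ?p}.
          (v ^ l * fps_nth (?u l) i) * fps_nth (?R l) (d - ?p - i)))"
    by (intro euler_comb_add euler_comb_sum) auto
  then show ?case by (simp only: e[symmetric]) (simp add: polar_limit_def)
qed

text \<open>\<open>approx\<close> speaks of indices m \<ge> 1 only, so the pole at 0 is treated
  apart; for a single pole plain convergence is enough.\<close>

lemma polar_series_0_tendsto:
  assumes "regular_params r p y"
  shows "(\<lambda>K. fps_nth (polar_series K r p y 0) d) \<longlonglongrightarrow> fps_nth (polar_limit r p y 0) d"
  using assms
proof (induction r arbitrary: d)
  case 0
  then show ?case by (simp add: polar_series_def polar_limit_def)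
next
  case (Suc r)
  let ?p = "p (Suc r)" and ?y = "y (Suc r)"
  have IH: "(\<lambda>K. fps_nth (polar_series K r p y 0) d) \<longlonglongrightarrow> fps_nth (polar_limit r p y 0) d" for d
    using Suc by (simp add: regular_params_Suc)
  have R: "(\<lambda>K. fps_nth (regular_part K ?p ?y 0) i) \<longlonglongrightarrow> fps_nth (regular_limit ?p ?y 0) i" for i
  proof -
    have "(\<lambda>K. zeta_partial K (?p + i) ?y 0) \<longlonglongrightarrow> Li (?p + i) ?y (0 + 1)"
      using Suc.prems by (intro zeta_partial_tendsto nonpole_0) (auto simp: regular_params_Suc)
    from tendsto_mult_left[OF this, of "binom_coeff ?p i"] show ?thesis
      by (simp add: regular_part_def regular_limit_def)
  qed
  have "(\<lambda>K. fps_nth (polar_series K r p y 0 * (1 + fps_X ^ ?p * regular_part K ?p ?y 0)) d)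
      \<longlonglongrightarrow> fps_nth (polar_limit r p y 0 * (1 + fps_X ^ ?p * regular_limit ?p ?y 0)) d"
    unfolding fps_nth_mult_one_plus by (cases "?p \<le> d") (auto intro!: tendsto_intros IH R)
  then show ?case by (simp add: polar_series_def polar_limit_def)
qed

text \<open>At l = 0 the partial sums are empty and only values of \<open>Li\<close> remain. The
  summands 1 produce constants, hence the ring and not the ideal.\<close>

lemma polar_limit_0_ring:
  assumes "\<And>j i. j \<in> {1..r} \<Longrightarrow> Li (p j + i) (y j) 1 \<in> comb_ring H G"
  shows "fps_nth (polar_limit r p y 0) d \<in> comb_ring H G"
  using assms
proof (induction r arbitrary: d)
  case 0
  then show ?case by (auto simp: polar_limit_def intro: comb_ring_scalar rat_adjoin.one rat_adjoin_0)
next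
  case (Suc r)
  let ?p = "p (Suc r)" and ?y = "y (Suc r)"
  have IH: "fps_nth (polar_limit r p y 0) d \<in> comb_ring H G" for d using Suc by simp
  have R: "fps_nth (regular_limit ?p ?y 0) i \<in> comb_ring H G" for i
    using Suc.prems by (auto simp: regular_limit_def intro!: comb_ring_mult comb_ring_scalar[OF binom_coeff_rat_adjoin])
  have "fps_nth (polar_limit r p y 0 * (1 + fps_X ^ ?p * regular_limit ?p ?y 0)) d \<in> comb_ring H G"
    unfolding fps_nth_mult_one_plus
    by (auto intro!: comb_ring_add comb_ring_sum comb_ring_mult IH R comb_ring_scalar[OF rat_adjoin_0])
  then show ?case by (simp add: polar_limit_def)
qed

section \<open>Limits of the two halves of the bilateral sum\<close>

text \<open>When the product is multiplied out, degree r is reached only by choosing the partial sum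
  in every factor. Every other choice has fewer partial sums and goes into \<open>g\<close>.\<close>

lemma euler_comb_expand:
  assumes v: "root_of_unity v" "q \<ge> 1" "(q, v) \<noteq> (1, 1)" and "regular_params r p w"
    and "\<And>j. j \<in> {1..r} \<Longrightarrow> root_of_unity (u j)"
    and "\<And>j. j \<in> {1..r} \<Longrightarrow> c j \<in> comb_ring H G \<and> d j \<in> comb_ring H G \<and> e j \<in> comb_ring H G"
  shows "\<exists>g. euler_comb (comb_ring H G) b r g \<and> (\<forall>n. v ^ n / (of_nat n + b) ^ q *
      (\<Prod>j=1..r. c j + d j * (u j ^ n / (of_nat n + b) ^ p j) + e j * zeta_partial n (p j) (w j) b)
    = (\<Prod>j=1..r. e j) * euler_monomial b r p q w v n + g n)"
  using assms(4-6)
proof (induction r)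
  case 0
  show ?case by (intro exI[of _ "\<lambda>_. 0"]) (simp add: euler_comb.zero euler_monomial_def)
next
  case (Suc r)
  let ?A = "comb_ring H G" and ?M = "euler_monomial b r p q w v"
  let ?c = "c (Suc r)" and ?d = "d (Suc r)" and ?e = "e (Suc r)"
  let ?t = "\<lambda>n. u (Suc r) ^ n / (of_nat n + b) ^ p (Suc r)" and ?z = "\<lambda>n. zeta_partial n (p (Suc r)) (w (Suc r)) b"
  define E where "E = (\<Prod>j=1..r. e j)"
  have "\<exists>g. euler_comb ?A b r g \<and> (\<forall>n. v ^ n / (of_nat n + b) ^ q *
      (\<Prod>j=1..r. c j + d j * (u j ^ n / (of_nat n + b) ^ p j) + e j * zeta_partial n (p j) (w j) b)
    = (\<Prod>j=1..r. e j) * ?M n + g n)"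
    using Suc.prems by (intro Suc.IH) (auto simp: regular_params_Suc)
  then obtain g where g: "euler_comb ?A b r g" "\<And>n. v ^ n / (of_nat n + b) ^ q *
      (\<Prod>j=1..r. c j + d j * (u j ^ n / (of_nat n + b) ^ p j) + e j * zeta_partial n (p j) (w j) b)
    = E * ?M n + g n" unfolding E_def by blast
  have E: "E \<in> ?A" unfolding E_def using Suc.prems(3)
    by (induction r) (auto intro: comb_ring_mult comb_ring_scalar rat_adjoin.one)
  have cde: "?c \<in> ?A" "?d \<in> ?A" "?e \<in> ?A" using Suc.prems(3)[of "Suc r"] by auto
  have u: "root_of_unity (u (Suc r))" "p (Suc r) \<ge> 1" "root_of_unity (w (Suc r))" "(p (Suc r), w (Suc r)) \<noteq> (1, 1)"
    using Suc.prems by (auto simp: regular_params_Suc)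
  have M: "euler_comb ?A b (Suc r) ?M"
    using Suc.prems(1) v by (intro euler_comb_monomial comb_ring_scalar rat_adjoin.one)
      (auto simp: convergent_params_def euler_sum_params_def regular_params_def)
  have g': "euler_comb ?A b (Suc r) g" using euler_comb_mono[OF g(1)] by simp
  \<comment> \<open>All products other than the new top monomial: the old top monomial with the
    constant or the power, and the old remainder with each of the three choices.\<close>
  define h where "h n = E * (?c * ?M n) + E * (?d * (?M n * ?t n)) + ?c * g n + ?d * (g n * ?t n) + ?e * (g n * ?z n)" for n
  have "euler_comb ?A b (Suc r) h" unfolding h_def[abs_def]
    by (intro euler_comb_add euler_comb_scale euler_comb_power euler_comb_zeta M g' g(1) E cde u)
  moreover have "v ^ n / (of_nat n + b) ^ q *
      (\<Prod>j=1..Suc r. c j + d j * (u j ^ n / (of_nat n + b) ^ p j) + e j * zeta_partial n (p j) (w j) b)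
    = (\<Prod>j=1..Suc r. e j) * euler_monomial b (Suc r) p q w v n + h n" for n
  proof -
    have "v ^ n / (of_nat n + b) ^ q *
      (\<Prod>j=1..Suc r. c j + d j * (u j ^ n / (of_nat n + b) ^ p j) + e j * zeta_partial n (p j) (w j) b)
      = (E * ?M n + g n) * (?c + ?d * ?t n + ?e * ?z n)"
      unfolding g(2)[symmetric] by simp
    also have "\<dots> = E * ?e * (?M n * ?z n) + h n" unfolding h_def by (simp only: algebra_simps)
    also have "?M n * ?z n = euler_monomial b (Suc r) p q w v n" by (simp add: euler_monomial_def)
    finally show ?thesis by (simp add: E_def)
  qed
  ultimately show ?case by blast
qed

lemma prod_power_mult:
  fixes y :: "nat \<Rightarrow> complex"
  shows "(\<Prod>j\<in>J. y j ^ m * f j) = (\<Prod>j\<in>J. y j) ^ m * (\<Prod>j\<in>J. f j)"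
  by (simp add: prod.distrib prod_power_distrib)

lemma euler_S_eq_suminf: "euler_S b k p q u v = (\<Sum>n. euler_monomial b k p q u v (Suc n))"
  by (simp add: euler_S_def euler_monomial_def)

text \<open>The outer power gives exponent 1, and the factors have exponent 0, so
  \<open>approx_sums\<close> replaces each truncated \<open>C j\<close> by its limit
  \<open>c j\<close>. \<open>euler_comb_expand\<close> then yields both the summability of the limit
  and its value modulo the ideal.\<close>

lemma euler_comb_expand_sums:
  assumes v: "root_of_unity v" "q \<ge> 1" "(q, v) \<noteq> (1, 1)" and w: "regular_params r p w"
    and u: "\<And>j. j \<in> {1..r} \<Longrightarrow> root_of_unity (u j)"
    and ring: "\<And>j. j \<in> {1..r} \<Longrightarrow> c j \<in> comb_ring H G \<and> d j \<in> comb_ring H G \<and> e j \<in> comb_ring H G"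
    and b: "nonpole b"
    and G: "\<And>k p q u v. k < r \<Longrightarrow> euler_sum_params k p q u v \<Longrightarrow> euler_S b k p q u v \<in> G"
    and c: "\<And>j. j \<in> {1..r} \<Longrightarrow> approx 0 (C j) (\<lambda>_. c j)"
  shows "\<exists>t\<in>comb_ideal H G. (\<lambda>K. \<Sum>m=1..K. v ^ m / (of_nat m + b) ^ q *
      (\<Prod>j=1..r. C j K m + d j * (u j ^ m / (of_nat m + b) ^ p j) + e j * zeta_partial m (p j) (w j) b))
    \<longlonglongrightarrow> (\<Prod>j=1..r. e j) * euler_S b r p q w v + t"
proof -
  let ?M = "euler_monomial b r p q w v"
  define f where "f m = v ^ m / (of_nat m + b) ^ q *
      (\<Prod>j=1..r. c j + d j * (u j ^ m / (of_nat m + b) ^ p j) + e j * zeta_partial m (p j) (w j) b)" for m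
  obtain g where g: "euler_comb (comb_ring H G) b r g" "\<And>n. f n = (\<Prod>j=1..r. e j) * ?M n + g n"
    using euler_comb_expand[OF v w, where u = u and c = c and d = d and e = e and b = b] u ring unfolding f_def by blast
  have M: "summable (\<lambda>n. ?M (Suc n))"
    using v w b by (intro summable_monomial)
      (auto simp: convergent_params_def euler_sum_params_def regular_params_def)
  have g': "summable (\<lambda>n. g (Suc n))" by (rule euler_comb_summable[OF g(1) b])
  have "approx (1 + 0) (\<lambda>K m. v ^ m / (of_nat m + b) ^ q *
      (\<Prod>j=1..r. C j K m + d j * (u j ^ m / (of_nat m + b) ^ p j) + e j * zeta_partial m (p j) (w j) b)) f"
    unfolding f_def[abs_def]
    using v w u by (intro approx_mult approx_prod approx_add approx_scale approx_zeta approx_power b c)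
      (auto simp: regular_params_def root_of_unity_norm)
  moreover have "summable (\<lambda>n. f (Suc n))" unfolding g(2) by (intro summable_add summable_mult M g')
  ultimately have "(\<lambda>K. \<Sum>m=1..K. v ^ m / (of_nat m + b) ^ q *
      (\<Prod>j=1..r. C j K m + d j * (u j ^ m / (of_nat m + b) ^ p j) + e j * zeta_partial m (p j) (w j) b))
      \<longlonglongrightarrow> (\<Sum>n. f (Suc n))" by (intro approx_sums) simp
  moreover have "(\<Sum>n. f (Suc n)) = (\<Prod>j=1..r. e j) * euler_S b r p q w v + (\<Sum>n. g (Suc n))"
    unfolding g(2) euler_S_eq_suminf
    by (simp only: suminf_add[OF summable_mult[OF M] g', symmetric] suminf_mult[OF M])
  ultimately show ?thesis using euler_comb_suminf[OF g(1) b G] by auto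
qed

text \<open>The powers split off by \<open>hurwitz_trunc_right\<close> combine with that of x into
  one m-th power. Each partial sum enters with coefficient -1, whence (-1)^r.\<close>

lemma right_sum_tendsto:
  assumes y: "regular_params r p y" and x: "root_of_unity x" and q: "q \<ge> 1" "(q, x * (\<Prod>j=1..r. y j)) \<noteq> (1, 1)"
    and b: "nonpole (a - 1)"
    and G: "\<And>k p q u v. k < r \<Longrightarrow> euler_sum_params k p q u v \<Longrightarrow> euler_S (a - 1) k p q u v \<in> G"
    and L: "\<And>j. j \<in> {1..r} \<Longrightarrow> Li (p j) (y j) a \<in> comb_ring H G"
  shows "\<exists>t\<in>comb_ideal H G. (\<lambda>K. \<Sum>m=1..K. x * inverse x ^ m *
      ((\<Prod>j=1..r. hurwitz_trunc K (p j) (y j) (a + of_nat m - 1)) / (a + of_nat m - 1) ^ q))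
    \<longlonglongrightarrow> x * ((- 1) ^ r * euler_S (a - 1) r p q y (inverse (x * (\<Prod>j=1..r. y j))) + t)"
proof -
  define v where "v = inverse (x * (\<Prod>j=1..r. y j))"
  have y': "\<And>j. j \<in> {1..r} \<Longrightarrow> root_of_unity (y j)" using y by (auto simp: regular_params_def)
  have v: "root_of_unity v" unfolding v_def
    by (intro root_of_unity_inverse root_of_unity_mult root_of_unity_prod x y')
  have qv: "(q, v) \<noteq> (1, 1)" using q(2) by (auto simp only: v_def Pair_inject inverse_eq_1_iff)
  have "\<exists>t\<in>comb_ideal H G. (\<lambda>K. \<Sum>m=1..K. v ^ m / (of_nat m + (a - 1)) ^ q *
      (\<Prod>j=1..r. zeta_partial (K + m) (p j) (y j) (a - 1) + 1 * (y j ^ m / (of_nat m + (a - 1)) ^ p j)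
         + (- 1) * zeta_partial m (p j) (y j) (a - 1)))
    \<longlonglongrightarrow> (\<Prod>j=1..r. - 1) * euler_S (a - 1) r p q y v + t"
  proof (rule euler_comb_expand_sums[OF v q(1) qv y _ _ b G])
    fix j assume j: "j \<in> {1..r}"
    show "approx 0 (\<lambda>K m. zeta_partial (K + m) (p j) (y j) (a - 1)) (\<lambda>_. Li (p j) (y j) (a - 1 + 1))"
      using y j by (intro approx_zeta_tail b) (auto simp: regular_params_def)
    show "Li (p j) (y j) (a - 1 + 1) \<in> comb_ring H G \<and> 1 \<in> comb_ring H G \<and> - 1 \<in> comb_ring H G"
      using L[OF j] by (auto intro!: comb_ring_scalar rat_adjoin.one rat_adjoin.uminus)
  qed (use y' in auto)
  then obtain t where t: "t \<in> comb_ideal H G" "(\<lambda>K. \<Sum>m=1..K. v ^ m / (of_nat m + (a - 1)) ^ q *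
      (\<Prod>j=1..r. zeta_partial (K + m) (p j) (y j) (a - 1) + 1 * (y j ^ m / (of_nat m + (a - 1)) ^ p j)
         + (- 1) * zeta_partial m (p j) (y j) (a - 1)))
    \<longlonglongrightarrow> (\<Prod>j=1..r. - 1) * euler_S (a - 1) r p q y v + t" by blast
  have eq: "x * inverse x ^ m *
      ((\<Prod>j=1..r. hurwitz_trunc K (p j) (y j) (a + of_nat m - 1)) / (a + of_nat m - 1) ^ q)
    = x * (v ^ m / (of_nat m + (a - 1)) ^ q *
      (\<Prod>j=1..r. zeta_partial (K + m) (p j) (y j) (a - 1) + 1 * (y j ^ m / (of_nat m + (a - 1)) ^ p j)
         + (- 1) * zeta_partial m (p j) (y j) (a - 1)))" if "m \<in> {1..K}" for K m
  proof -
    have "(\<Prod>j=1..r. hurwitz_trunc K (p j) (y j) (a + of_nat m - 1))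
      = (\<Prod>j=1..r. inverse (y j) ^ m * (zeta_partial (K + m) (p j) (y j) (a - 1)
          + 1 * (y j ^ m / (of_nat m + (a - 1)) ^ p j) + (- 1) * zeta_partial m (p j) (y j) (a - 1)))"
      using that y' by (intro prod.cong refl) (subst hurwitz_trunc_right, auto dest: root_of_unity_nonzero)
    moreover have "x * inverse x ^ m * (\<Prod>j=1..r. inverse (y j)) ^ m = x * v ^ m"
      by (simp add: v_def power_mult_distrib prod_inversef[symmetric] o_def)
    moreover have "a + of_nat m - 1 = of_nat m + (a - 1)" by simp
    ultimately show ?thesis
      by (simp only: prod_power_mult times_divide_eq_right times_divide_eq_left mult.assoc[symmetric])
  qed
  have "(\<lambda>K. \<Sum>m=1..K. x * inverse x ^ m *
      ((\<Prod>j=1..r. hurwitz_trunc K (p j) (y j) (a + of_nat m - 1)) / (a + of_nat m - 1) ^ q))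
    \<longlonglongrightarrow> x * ((\<Prod>j=1..r. - 1) * euler_S (a - 1) r p q y v + t)"
    using tendsto_mult_left[OF t(2), of x] by (simp only: eq sum_distrib_left cong: sum.cong)
  then show ?thesis using t(1) unfolding v_def by (intro bexI[of _ t]) simp_all
qed

text \<open>By \<open>hurwitz_trunc_left\<close> each partial sum enters with (-1)^p_j, and
  reflecting the outer denominator gives (-1)^q.\<close>

lemma left_sum_tendsto:
  assumes y: "regular_params r p y" and x: "root_of_unity x" and q: "q \<ge> 1" "(q, x * (\<Prod>j=1..r. y j)) \<noteq> (1, 1)"
    and b: "nonpole (- a)" "nonpole (a - 1)"
    and G: "\<And>k p q u v. k < r \<Longrightarrow> euler_sum_params k p q u v \<Longrightarrow> euler_S (- a) k p q u v \<in> G"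
    and L: "\<And>j. j \<in> {1..r} \<Longrightarrow> Li (p j) (y j) a \<in> comb_ring H G"
    and H: "\<And>j. j \<in> {1..r} \<Longrightarrow> y j \<in> H"
  shows "\<exists>t\<in>comb_ideal H G. (\<lambda>K. \<Sum>m=1..K. x ^ m *
      ((\<Prod>j=1..r. hurwitz_trunc K (p j) (y j) (a - of_nat m)) / (a - of_nat m) ^ q))
    \<longlonglongrightarrow> (- 1) ^ q * ((- 1) ^ (\<Sum>j=1..r. p j)
        * euler_S (- a) r p q (\<lambda>j. inverse (y j)) (x * (\<Prod>j=1..r. y j)) + t)"
proof -
  define v where "v = x * (\<Prod>j=1..r. y j)"
  have y': "\<And>j. j \<in> {1..r} \<Longrightarrow> root_of_unity (y j)" using y by (auto simp: regular_params_def)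
  have v: "root_of_unity v" unfolding v_def by (intro root_of_unity_mult root_of_unity_prod x y')
  have qv: "(q, v) \<noteq> (1, 1)" using q by (auto simp: v_def)
  have w: "regular_params r p (\<lambda>j. inverse (y j))"
    using y by (auto simp: regular_params_def root_of_unity_inverse)
  \<comment> \<open>On this side no single term is added back; the middle summand with coefficient 0
    and base 1 fits the product to the common shape.\<close>
  have "\<exists>t\<in>comb_ideal H G. (\<lambda>K. \<Sum>m=1..K. v ^ m / (of_nat m + - a) ^ q *
      (\<Prod>j=1..r. inverse (y j) * zeta_partial (Suc K - m) (p j) (y j) (a - 1)
         + 0 * (1 ^ m / (of_nat m + - a) ^ p j)
         + (- 1) ^ p j * zeta_partial m (p j) (inverse (y j)) (- a)))
    \<longlonglongrightarrow> (\<Prod>j=1..r. (- 1) ^ p j) * euler_S (- a) r p q (\<lambda>j. inverse (y j)) v + t"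
  proof (rule euler_comb_expand_sums[OF v q(1) qv w _ _ b(1) G])
    fix j assume j: "j \<in> {1..r}"
    show "approx 0 (\<lambda>K m. inverse (y j) * zeta_partial (Suc K - m) (p j) (y j) (a - 1))
        (\<lambda>_. inverse (y j) * Li (p j) (y j) (a - 1 + 1))"
      using y j by (intro approx_scale approx_zeta_tail b) (auto simp: regular_params_def)
    show "inverse (y j) * Li (p j) (y j) (a - 1 + 1) \<in> comb_ring H G \<and> 0 \<in> comb_ring H G
        \<and> (- 1) ^ p j \<in> comb_ring H G"
      using L[OF j] comb_ring_mult[OF comb_ring_scalar[OF rat_adjoin_inverse[OF rat_adjoin.incl[OF H[OF j]]]]]
      by (auto intro!: comb_ring_scalar rat_adjoin_0 rat_adjoin_minus_one_power)
  qed auto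
  then obtain t where t: "t \<in> comb_ideal H G" "(\<lambda>K. \<Sum>m=1..K. v ^ m / (of_nat m + - a) ^ q *
      (\<Prod>j=1..r. inverse (y j) * zeta_partial (Suc K - m) (p j) (y j) (a - 1)
         + 0 * (1 ^ m / (of_nat m + - a) ^ p j)
         + (- 1) ^ p j * zeta_partial m (p j) (inverse (y j)) (- a)))
    \<longlonglongrightarrow> (\<Prod>j=1..r. (- 1) ^ p j) * euler_S (- a) r p q (\<lambda>j. inverse (y j)) v + t" by blast
  have eq: "x ^ m * ((\<Prod>j=1..r. hurwitz_trunc K (p j) (y j) (a - of_nat m)) / (a - of_nat m) ^ q)
    = (- 1) ^ q * (v ^ m / (of_nat m + - a) ^ q *
      (\<Prod>j=1..r. inverse (y j) * zeta_partial (Suc K - m) (p j) (y j) (a - 1)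
         + 0 * (1 ^ m / (of_nat m + - a) ^ p j)
         + (- 1) ^ p j * zeta_partial m (p j) (inverse (y j)) (- a)))" if "m \<in> {1..K}" for K m
  proof -
    define Z where "Z = (\<Prod>j=1..r. inverse (y j) * zeta_partial (Suc K - m) (p j) (y j) (a - 1)
         + 0 * (1 ^ m / (of_nat m + - a) ^ p j)
         + (- 1) ^ p j * zeta_partial m (p j) (inverse (y j)) (- a))"
    have "(\<Prod>j=1..r. hurwitz_trunc K (p j) (y j) (a - of_nat m))
      = (\<Prod>j=1..r. y j ^ m * (inverse (y j) * zeta_partial (Suc K - m) (p j) (y j) (a - 1)
         + 0 * (1 ^ m / (of_nat m + - a) ^ p j)
         + (- 1) ^ p j * zeta_partial m (p j) (inverse (y j)) (- a)))"
      using that y' by (intro prod.cong refl) (subst hurwitz_trunc_left, auto dest: root_of_unity_nonzero)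
    then have "(\<Prod>j=1..r. hurwitz_trunc K (p j) (y j) (a - of_nat m)) = (\<Prod>j=1..r. y j) ^ m * Z"
      by (simp only: prod_power_mult Z_def)
    then show ?thesis unfolding reflect_power Z_def[symmetric] v_def
      by (cases "even q") (simp_all add: power_mult_distrib)
  qed
  have "(\<lambda>K. \<Sum>m=1..K. x ^ m *
      ((\<Prod>j=1..r. hurwitz_trunc K (p j) (y j) (a - of_nat m)) / (a - of_nat m) ^ q))
    \<longlonglongrightarrow> (- 1) ^ q * ((\<Prod>j=1..r. (- 1) ^ p j) * euler_S (- a) r p q (\<lambda>j. inverse (y j)) v + t)"
    using tendsto_mult_left[OF t(2), of "(- 1) ^ q"] by (simp only: eq sum_distrib_left cong: sum.cong)
  then show ?thesis using t(1) unfolding v_def by (intro bexI[of _ t]) (simp_all add: power_sum)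
qed

text \<open>Each polar coefficient is multiplied by a truncated bilateral sum whose limit
  \<open>U i\<close> lies in the ideal and does not depend on the pole. Hence the sum over k splits
  into \<open>U i\<close> times a combination of classical sums of degree below r.\<close>

lemma polar_sum_tendsto:
  assumes y: "regular_params r p y" and x: "root_of_unity x" "x \<noteq> 1" and q: "q \<ge> 1" "(q, x * (\<Prod>j=1..r. y j)) \<noteq> (1, 1)"
    and b: "nonpole (- a)" "nonpole (a - 1)"
    and G: "\<And>k p q u v. k < r \<Longrightarrow> euler_sum_params k p q u v \<Longrightarrow> classical_euler_S k p q u v \<in> G"
    and L: "\<And>j i. j \<in> {1..r} \<Longrightarrow> Li (p j + i) (y j) 1 \<in> comb_ring H G"
    and T: "\<And>i. i \<ge> 1 \<Longrightarrow> Li i (inverse x) a \<in> G" "\<And>i. i \<ge> 1 \<Longrightarrow> Li i x (1 - a) \<in> G"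
    and H: "x \<in> H"
  defines "P \<equiv> (\<Sum>j=1..r. p j)" and "Y \<equiv> (\<Prod>j=1..r. y j)"
  shows "\<exists>u\<in>comb_ideal H G. (\<lambda>K.
      (\<Sum>i=1..P+q. fps_nth (polar_series K r p y 0) (P + q - i) *
         (x * zeta_partial K i (inverse x) (a - 1) + (- 1) ^ i * zeta_partial K i x (- a)))
    + (\<Sum>k=1..K. \<Sum>i=1..P. (x * Y) ^ k * fps_nth (inv_lin_pow q (- of_nat k) * polar_series K r p y k) (P - i) *
         (x * zeta_partial (K + k) i (inverse x) (a - 1) + (- 1) ^ i * zeta_partial (K - k) i x (- a))))
    \<longlonglongrightarrow> u"
proof -
  \<comment> \<open>The value of the bilateral sum of x^(-n) / (n + a)^i, with the halves n \<ge> 0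
    and n < 0 in this order.\<close>
  define U where "U i = x * Li i (inverse x) a + (- 1) ^ i * Li i x (1 - a)" for i
  have U: "U i \<in> comb_ideal H G" if "i \<ge> 1" for i
    unfolding U_def using T that H
    by (intro comb_ideal_add comb_ideal_scale comb_ideal_gen rat_adjoin.incl rat_adjoin_minus_one_power)
  \<comment> \<open>This is where x \<noteq> 1 enters: both halves converge also for i = 1.\<close>
  have x': "root_of_unity (inverse x)" "(i, inverse x) \<noteq> (1, 1)" "(i, x) \<noteq> (1, 1)" for i
    using x by (auto simp: root_of_unity_inverse)
  have v: "root_of_unity (x * Y)" unfolding Y_def
    using y by (intro root_of_unity_mult root_of_unity_prod x) (auto simp: regular_params_def)
  have U0: "(\<lambda>K. x * zeta_partial K i (inverse x) (a - 1) + (- 1) ^ i * zeta_partial K i x (- a)) \<longlonglongrightarrow> U i"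
    if "i \<ge> 1" for i
  proof -
    have "(\<lambda>K. zeta_partial K i (inverse x) (a - 1)) \<longlonglongrightarrow> Li i (inverse x) (a - 1 + 1)"
      by (rule zeta_partial_tendsto[OF x'(1) that x'(2) b(2)])
    moreover have "(\<lambda>K. zeta_partial K i x (- a)) \<longlonglongrightarrow> Li i x (- a + 1)"
      by (rule zeta_partial_tendsto[OF x(1) that x'(3) b(1)])
    ultimately show ?thesis unfolding U_def by (intro tendsto_intros) (simp_all add: add.commute)
  qed
  have Uk: "approx 0 (\<lambda>K k. x * zeta_partial (K + k) i (inverse x) (a - 1) + (- 1) ^ i * zeta_partial (K - k) i x (- a)) (\<lambda>_. U i)"
    if "i \<ge> 1" for i
  proof -
    have "approx 0 (\<lambda>K k. x * zeta_partial (K + k) i (inverse x) (a - 1) + (- 1) ^ i * zeta_partial (K - k) i x (- a))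
      (\<lambda>_. x * Li i (inverse x) (a - 1 + 1) + (- 1) ^ i * Li i x (- a + 1))"
      using that by (intro approx_add approx_scale approx_zeta_tail x x' b) auto
    then show ?thesis by (simp add: U_def add.commute)
  qed
  let ?f = "\<lambda>i k. (x * Y) ^ k * fps_nth (inv_lin_pow q (- of_nat k) * polar_limit r p y k) (P - i)"
  \<comment> \<open>The index P - i is below P because i \<ge> 1, so the degree drops below
    r.\<close>
  have f: "euler_comb (comb_ring H G) 0 r (?f i)" if "i \<in> {1..P}" for i
    using euler_comb_polar[OF y v q(1) q(2)[folded Y_def] L, of "P - i"] that by (auto simp: P_def)
  have "(\<lambda>K. \<Sum>k=1..K. (x * Y) ^ k * fps_nth (inv_lin_pow q (- of_nat k) * polar_series K r p y k) (P - i) *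
         (x * zeta_partial (K + k) i (inverse x) (a - 1) + (- 1) ^ i * zeta_partial (K - k) i x (- a)))
       \<longlonglongrightarrow> (\<Sum>n. ?f i (Suc n)) * U i" if i: "i \<in> {1..P}" for i
  proof -
    have s: "summable (\<lambda>n. ?f i (Suc n))" by (rule euler_comb_summable[OF f[OF i] nonpole_0])
    have "approx (1 + 0) (\<lambda>K k. (x * Y) ^ k * fps_nth (inv_lin_pow q (- of_nat k) * polar_series K r p y k) (P - i) *
         (x * zeta_partial (K + k) i (inverse x) (a - 1) + (- 1) ^ i * zeta_partial (K - k) i x (- a)))
       (\<lambda>k. ?f i k * U i)"
      using i by (intro approx_mult approx_polar[OF y v q(1)] Uk) auto
    then have "(\<lambda>K. \<Sum>k=1..K. (x * Y) ^ k * fps_nth (inv_lin_pow q (- of_nat k) * polar_series K r p y k) (P - i) *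
         (x * zeta_partial (K + k) i (inverse x) (a - 1) + (- 1) ^ i * zeta_partial (K - k) i x (- a)))
       \<longlonglongrightarrow> (\<Sum>n. ?f i (Suc n) * U i)"
      by (intro approx_sums summable_mult2 s) simp
    then show ?thesis by (simp only: suminf_mult2[OF s, symmetric])
  qed
  then have "(\<lambda>K.
      (\<Sum>i=1..P+q. fps_nth (polar_series K r p y 0) (P + q - i) *
         (x * zeta_partial K i (inverse x) (a - 1) + (- 1) ^ i * zeta_partial K i x (- a)))
    + (\<Sum>i=1..P. \<Sum>k=1..K. (x * Y) ^ k * fps_nth (inv_lin_pow q (- of_nat k) * polar_series K r p y k) (P - i) *
         (x * zeta_partial (K + k) i (inverse x) (a - 1) + (- 1) ^ i * zeta_partial (K - k) i x (- a))))
    \<longlonglongrightarrow> (\<Sum>i=1..P+q. fps_nth (polar_limit r p y 0) (P + q - i) * U i)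
      + (\<Sum>i=1..P. (\<Sum>n. ?f i (Suc n)) * U i)"
    by (intro tendsto_add tendsto_sum tendsto_mult polar_series_0_tendsto[OF y] U0) auto
  moreover have "(\<Sum>i=1..P+q. fps_nth (polar_limit r p y 0) (P + q - i) * U i)
      + (\<Sum>i=1..P. (\<Sum>n. ?f i (Suc n)) * U i) \<in> comb_ideal H G"
    using euler_comb_suminf[OF f nonpole_0 G]
    by (intro comb_ideal_add comb_ideal_sum comb_ideal_ring_mult polar_limit_0_ring[OF L]
      comb_ideal_mult U) auto
  moreover have "(\<Sum>k=1..K. \<Sum>i=1..P. (x * Y) ^ k * fps_nth (inv_lin_pow q (- of_nat k) * polar_series K r p y k) (P - i) *
         (x * zeta_partial (K + k) i (inverse x) (a - 1) + (- 1) ^ i * zeta_partial (K - k) i x (- a)))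
    = (\<Sum>i=1..P. \<Sum>k=1..K. (x * Y) ^ k * fps_nth (inv_lin_pow q (- of_nat k) * polar_series K r p y k) (P - i) *
         (x * zeta_partial (K + k) i (inverse x) (a - 1) + (- 1) ^ i * zeta_partial (K - k) i x (- a)))" for K
    by (rule sum.swap)
  ultimately show ?thesis by (intro bexI) simp_all
qed

section \<open>The finite identity and the conclusion\<close>

text \<open>Both sides are finite: the summand is expanded at every point of the progression, the
  order of summation is exchanged, and the sum over m is evaluated by
  \<open>shifted_bilateral_sum\<close>. The factor x^k arising there joins Y^k.\<close>

lemma bilateral_sum_eq:
  assumes s: "\<And>n. a + of_int n \<noteq> 0" and x: "x \<noteq> 0" and y: "regular_params r p y" and q: "q \<ge> 1"
  defines "P \<equiv> (\<Sum>j=1..r. p j)" and "Y \<equiv> (\<Prod>j=1..r. y j)"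
  shows "(\<Sum>m=1..K. x * inverse x ^ m *
      ((\<Prod>j=1..r. hurwitz_trunc K (p j) (y j) (a + of_nat m - 1)) / (a + of_nat m - 1) ^ q))
    + (\<Sum>m=1..K. x ^ m * ((\<Prod>j=1..r. hurwitz_trunc K (p j) (y j) (a - of_nat m)) / (a - of_nat m) ^ q))
    = (\<Sum>i=1..P+q. fps_nth (polar_series K r p y 0) (P + q - i) *
         (x * zeta_partial K i (inverse x) (a - 1) + (- 1) ^ i * zeta_partial K i x (- a)))
    + (\<Sum>k=1..K. \<Sum>i=1..P. (x * Y) ^ k * fps_nth (inv_lin_pow q (- of_nat k) * polar_series K r p y k) (P - i) *
         (x * zeta_partial (K + k) i (inverse x) (a - 1) + (- 1) ^ i * zeta_partial (K - k) i x (- a)))"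
proof -
  define A where "A i = fps_nth (polar_series K r p y 0) (P + q - i)" for i
  define B where "B k i = Y ^ k * fps_nth (inv_lin_pow q (- of_nat k) * polar_series K r p y k) (P - i)" for k i
  have exp: "(\<Prod>j=1..r. hurwitz_trunc K (p j) (y j) s) / s ^ q
    = (\<Sum>i=1..P+q. A i / s ^ i) + (\<Sum>k=1..K. \<Sum>i=1..P. B k i / (s + of_nat k) ^ i)"
    if "\<And>k. s + of_nat k \<noteq> 0" for s
    unfolding A_def B_def P_def Y_def
    using y by (intro hurwitz_product_expansion that q) (auto simp: regular_params_def dest: root_of_unity_nonzero)
  have right: "a + of_nat m - 1 + of_nat k \<noteq> 0" and left: "a - of_nat m + of_nat k \<noteq> 0" for m k
    using s[of "int m - 1 + int k"] s[of "- int m + int k"] by (simp_all add: algebra_simps)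
  define g where "g k i m = x * inverse x ^ m / (a + of_nat m - 1 + of_nat k) ^ i
      + x ^ m / (a - of_nat m + of_nat k) ^ i" for k i m
  define E where "E k i = (\<Sum>m=1..K. g k i m)" for k i
  have swap: "(\<Sum>m=1..K. \<Sum>i=1..N. C i * g k i m) = (\<Sum>i=1..N. C i * E k i)" for C k N
    unfolding E_def sum_distrib_left by (rule sum.swap)
  have "(\<Sum>m=1..K. x * inverse x ^ m *
      ((\<Prod>j=1..r. hurwitz_trunc K (p j) (y j) (a + of_nat m - 1)) / (a + of_nat m - 1) ^ q))
    + (\<Sum>m=1..K. x ^ m * ((\<Prod>j=1..r. hurwitz_trunc K (p j) (y j) (a - of_nat m)) / (a - of_nat m) ^ q))
    = (\<Sum>m=1..K. (\<Sum>i=1..P+q. A i * g 0 i m) + (\<Sum>k=1..K. \<Sum>i=1..P. B k i * g k i m))"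
    unfolding exp[OF right] exp[OF left] sum.distrib[symmetric] g_def
    by (intro sum.cong refl) (simp add: distrib_left sum_distrib_left sum.distrib mult_ac)
  also have "\<dots> = (\<Sum>i=1..P+q. A i * E 0 i) + (\<Sum>k=1..K. \<Sum>i=1..P. B k i * E k i)"
  proof -
    have "(\<Sum>m=1..K. \<Sum>k=1..K. \<Sum>i=1..P. B k i * g k i m) = (\<Sum>k=1..K. \<Sum>m=1..K. \<Sum>i=1..P. B k i * g k i m)"
      by (rule sum.swap)
    then show ?thesis by (simp only: sum.distrib swap)
  qed
  also have "(\<Sum>i=1..P+q. A i * E 0 i) = (\<Sum>i=1..P+q. A i *
         (x * zeta_partial K i (inverse x) (a - 1) + (- 1) ^ i * zeta_partial K i x (- a)))"
    unfolding E_def g_def using shifted_bilateral_sum[OF x, of 0 K a] by simp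
  also have "(\<Sum>k=1..K. \<Sum>i=1..P. B k i * E k i) = (\<Sum>k=1..K. \<Sum>i=1..P.
         (x * Y) ^ k * fps_nth (inv_lin_pow q (- of_nat k) * polar_series K r p y k) (P - i) *
         (x * zeta_partial (K + k) i (inverse x) (a - 1) + (- 1) ^ i * zeta_partial (K - k) i x (- a)))"
  proof (intro sum.cong refl)
    fix k i assume "k \<in> {1..K}"
    then have "E k i = x ^ k * (x * zeta_partial (K + k) i (inverse x) (a - 1)
        + (- 1) ^ i * zeta_partial (K - k) i x (- a))"
      unfolding E_def g_def by (intro shifted_bilateral_sum x) auto
    then show "B k i * E k i = (x * Y) ^ k * fps_nth (inv_lin_pow q (- of_nat k) * polar_series K r p y k) (P - i) *
         (x * zeta_partial (K + k) i (inverse x) (a - 1) + (- 1) ^ i * zeta_partial (K - k) i x (- a))"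
      by (simp only: B_def power_mult_distrib mult_ac)
  qed
  finally show ?thesis unfolding A_def .
qed

theorem theorem3p13:
  fixes r q :: nat and p :: "nat \<Rightarrow> nat" and x a :: complex and xs :: "nat \<Rightarrow> complex"
  assumes "r \<ge> 1"
    and "root_of_unity x" and "x \<noteq> 1"
    and "\<forall>j\<in>{1..r}. root_of_unity (xs j)"
    and "a \<notin> \<int>"
    and "\<forall>j\<in>{1..r}. p j \<ge> 1" and "q \<ge> 1"
    and "\<forall>j\<in>{1..r}. (p j, xs j) \<noteq> (1, 1)"
    and "(q, x * (\<Prod>j=1..r. xs j)) \<noteq> (1, 1)"
  shows "x * euler_S (a - 1) r p q xs (inverse (x * (\<Prod>j=1..r. xs j)))
         + (- 1) ^ ((\<Sum>j=1..r. p j) + q + r)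
             * euler_S (- a) r p q (\<lambda>j. inverse (xs j)) (x * (\<Prod>j=1..r. xs j))
         \<in> linear_combinations (rat_adjoin (insert x (xs ` {1..r})))
             (finite_products (Li_values a \<union> lower_euler_sums a r))"
proof -
  define H where "H = insert x (xs ` {1..r})"
  define G where "G = Li_values a \<union> lower_euler_sums a r"
  define P where "P = (\<Sum>j=1..r. p j)"
  define S where "S = euler_S (a - 1) r p q xs (inverse (x * (\<Prod>j=1..r. xs j)))"
  define S' where "S' = euler_S (- a) r p q (\<lambda>j. inverse (xs j)) (x * (\<Prod>j=1..r. xs j))"
  have xs: "regular_params r p xs" using assms by (auto simp: regular_params_def)
  have shift: "a + of_int n \<noteq> 0" for n
    using assms(5) by (metis Ints_minus Ints_of_int add_eq_0_iff minus_minus)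
  \<comment> \<open>Up to sign, n - a and n + a - 1 are a plus an integer.\<close>
  have b: "nonpole (- a)" "nonpole (a - 1)"
    unfolding nonpole_def using shift[of "- int n" for n] shift[of "int n - 1" for n]
    by (auto simp: algebra_simps)
  have Li: "Li m w b \<in> G" if "m \<ge> 1" "root_of_unity w" "(m, w) \<noteq> (1, 1)" "b \<in> {1, a, 1 - a}" for m w b
    using that unfolding G_def Li_values_def by blast
  have Li': "Li m w b \<in> comb_ring H G"
    if "m \<ge> 1" "root_of_unity w" "(m, w) \<noteq> (1, 1)" "b \<in> {1, a, 1 - a}" for m w b
    by (intro comb_ring_ideal comb_ideal_gen Li that)
  have lower: "euler_S c k p q u v \<in> G" if "k < r" "euler_sum_params k p q u v" "c \<in> {a - 1, - a, 0}" for c k p q u v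
    using that unfolding G_def lower_euler_sums_def by blast
  have x: "root_of_unity (inverse x)" "inverse x \<noteq> 1"
    using assms by (auto simp: root_of_unity_inverse)
  have params: "p j \<ge> 1" "root_of_unity (xs j)" "(p j + i, xs j) \<noteq> (1, 1)" "xs j \<in> H" if "j \<in> {1..r}" for i j
  proof -
    have "p j \<ge> 1" "(p j, xs j) \<noteq> (1, 1)" using that assms(6,8) by blast+
    then show "p j \<ge> 1" "(p j + i, xs j) \<noteq> (1, 1)" by (cases i; auto)+
  qed (use that assms(4) in \<open>auto simp: H_def\<close>)
  have xH: "x \<in> H" by (simp add: H_def)
  have lower_a: "euler_S (a - 1) k p q u v \<in> G" and lower_b: "euler_S (- a) k p q u v \<in> G"
    and lower_0: "euler_S 0 k p q u v \<in> G" if "k < r" "euler_sum_params k p q u v" for k p q u v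
    using lower[OF that] by simp_all
  have LiA: "Li (p j) (xs j) a \<in> comb_ring H G" if "j \<in> {1..r}" for j
    using params(1,2)[OF that] params(3)[OF that, of 0] by (intro Li') simp_all
  have Li1: "Li (p j + i) (xs j) 1 \<in> comb_ring H G" if "j \<in> {1..r}" for i j
    using params(1,2)[OF that] params(3)[OF that, of i] by (intro Li') simp_all
  have LiT: "Li i (inverse x) a \<in> G" "Li i x (1 - a) \<in> G" if "i \<ge> 1" for i
    using that x assms(2,3) by (auto intro!: Li)
  obtain t where t: "t \<in> comb_ideal H G" "(\<lambda>K. \<Sum>m=1..K. x * inverse x ^ m *
      ((\<Prod>j=1..r. hurwitz_trunc K (p j) (xs j) (a + of_nat m - 1)) / (a + of_nat m - 1) ^ q))
    \<longlonglongrightarrow> x * ((- 1) ^ r * S + t)"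
    using right_sum_tendsto[OF xs assms(2,7,9) b(2) lower_a LiA] unfolding S_def by blast
  obtain t' where t': "t' \<in> comb_ideal H G" "(\<lambda>K. \<Sum>m=1..K. x ^ m *
      ((\<Prod>j=1..r. hurwitz_trunc K (p j) (xs j) (a - of_nat m)) / (a - of_nat m) ^ q))
    \<longlonglongrightarrow> (- 1) ^ q * ((- 1) ^ P * S' + t')"
    using left_sum_tendsto[OF xs assms(2,7,9) b lower_b LiA params(4)] unfolding S'_def P_def by blast
  obtain u where u: "u \<in> comb_ideal H G" "(\<lambda>K. (\<Sum>m=1..K. x * inverse x ^ m *
      ((\<Prod>j=1..r. hurwitz_trunc K (p j) (xs j) (a + of_nat m - 1)) / (a + of_nat m - 1) ^ q))
    + (\<Sum>m=1..K. x ^ m * ((\<Prod>j=1..r. hurwitz_trunc K (p j) (xs j) (a - of_nat m)) / (a - of_nat m) ^ q)))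
    \<longlonglongrightarrow> u"
    unfolding bilateral_sum_eq[OF shift root_of_unity_nonzero[OF assms(2)] xs assms(7)]
    using polar_sum_tendsto[OF xs assms(2,3,7,9) b lower_0 Li1 LiT] by (blast intro: xH)
  \<comment> \<open>The halves converge separately, and by the finite identity their sum also has
    the limit \<open>u\<close>.\<close>
  have "x * ((- 1) ^ r * S + t) + (- 1) ^ q * ((- 1) ^ P * S' + t') = u"
    by (rule LIMSEQ_unique[OF tendsto_add[OF t(2) t'(2)] u(2)])
  then have "x * (- 1) ^ r * S + (- 1) ^ (P + q) * S' = u + (- x) * t + (- ((- 1) ^ q)) * t'"
    by (simp add: algebra_simps power_add eq_diff_eq)
  \<comment> \<open>Multiplying by (-1)^r turns the coefficient of \<open>S\<close> into x and that
    of \<open>S'\<close> into the sign with exponent P + q + r.\<close>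
  then have "(- 1) ^ r * (x * (- 1) ^ r * S + (- 1) ^ (P + q) * S')
      = (- 1) ^ r * (u + (- x) * t + (- ((- 1) ^ q)) * t')" by simp
  moreover have "(- 1) ^ r * (x * (- 1) ^ r * S + (- 1) ^ (P + q) * S') = x * S + (- 1) ^ (P + q + r) * S'"
    by (cases "even r") (simp_all add: power_add)
  moreover have "(- 1) ^ r * (u + (- x) * t + (- ((- 1) ^ q)) * t') \<in> comb_ideal H G"
    by (intro comb_ideal_scale comb_ideal_add rat_adjoin_minus_one_power rat_adjoin.uminus t u t' rat_adjoin.incl)
      (simp add: H_def)
  ultimately show ?thesis
    unfolding comb_ideal_def S_def S'_def P_def H_def G_def by simp
qed

end
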